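(* Let $H$ be a commutative compact hypergroup with normalized Haar measure $\lambda_H$, and let $\varpi$ be the Plancherel measure on the dual space $\widehat{H}$. Then for every $\pi\in\widehat{H}$, $\varpi(\{\pi\})=k_\pi$, where $k_\pi$ is the hyperdimension of $\pi$.
   Context: Hypergroup is meant in the sense of Jewett: a locally compact Hausdorff space $H$ with a bilinear associative convolution $*$ on the space $M(H)$ of bounded Borel measures such that: $\delta_x*\delta_y$ is a compactly supported probability measure for all $x,y\in H$; $*$ is weakly continuous on $M(H)^+\times M(H)^+$; $(x,y)\mapsto\operatorname{supp}(\delta_x*\delta_y)$ is continuous into the space of nonempty compact subsets with the Michael topology; there is an identity $e$ with $\delta_e*\delta_x=\delta_x*\delta_e=\delta_x$; and there is an involutive homeomorphism $x\mapsto\tilde x$ with $(\delta_x*\delta_y)^{\sim}=\delta_{\tilde y}*\delta_{\tilde x}$ and $e\in\operatorname{supp}(\delta_x*\delta_y)$ iff $y=\tilde x$. It is commutative if $*$ is commutative. A Haar measure $\lambda_H$ is a nonzero positive Borel measure with $\int_H\int_H f\,d(\delta_x*\delta_y)\,d\lambda_H(y)=\int_H f\,d\lambda_H$ for all $x\in H$ and all $f\in C_c(H)$; for compact $H$ it exists and is normalized so that $\lambda_H(H)=1$. For a commutative compact hypergroup all irreducible representations are one-dimensional and the dual space $\widehat H$ (with the discrete topology) is the set of characters: continuous $\chi:H\to\mathbb{C}$ with $\chi(e)=1$, $\chi(\tilde x)=\overline{\chi(x)}$, and $\int_H\chi\,d(\delta_x*\delta_y)=\chi(x)\chi(y)$.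 The hyperdimension $k_\chi$ of $\chi\in\widehat H$ is the constant in the orthogonality relation $\int_H\chi\overline{\psi}\,d\lambda_H=\frac{1}{k_\chi}$ if $\psi=\chi$ and $0$ if $\psi\neq\chi$ (for $\chi,\psi\in\widehat H$). The Fourier transform is $\widehat f(\chi)=\int_H f\,\overline{\chi}\,d\lambda_H$. The Plancherel measure $\varpi$ is the measure on $\widehat H$ for which the Fourier transform restricts to an isometry of $L^2(H,\lambda_H)$ onto $\ell^2(\widehat H,\varpi)$. *)

theory Defs
  imports "HOL-Analysis.Analysis"
begin

section \<open>The space M(H) of bounded measures\<close>

text \<open>
  Complex measures are set functions vanishing outside the Borel sigma-algebra, so that equality of
  measures is equality of functions.
\<close>

type_synonym 'a cmeasure = "'a set \<Rightarrow> complex"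

text \<open>
  M(H) consists, as in Jewett's paper, of the \<^emph>\<open>regular\<close> complex Borel measures (boundedness is
  automatic for finite-valued countably additive set functions). The last clause is inner regularity of
  the total variation: a set has small variation iff all its Borel subsets have small measure.
\<close>

definition bounded_measures :: "'a::topological_space cmeasure set" where
  "bounded_measures = {\<mu>.
     (\<forall>A. A \<notin> sets borel \<longrightarrow> \<mu> A = 0) \<and>
     (\<forall>A :: nat \<Rightarrow> 'a set. range A \<subseteq> sets borel \<longrightarrow> disjoint_family A \<longrightarrow>
        (\<lambda>n. \<mu> (A n)) sums \<mu> (\<Union>n. A n)) \<and>
     (\<forall>A\<in>sets borel. \<forall>\<epsilon>>0. \<exists>K. compact K \<and> K \<in> sets borel \<and> K \<subseteq> A \<and>
        (\<forall>B\<in>sets borel. B \<subseteq> A - K \<longrightarrow> norm (\<mu> B) < \<epsilon>))}"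

definition positive_measures :: "'a::topological_space cmeasure set" where
  "positive_measures = {\<mu> \<in> bounded_measures. \<forall>A. \<mu> A \<in> \<real>\<^sub>\<ge>\<^sub>0}"

text \<open>Only meant for elements of \<^const>\<open>positive_measures\<close>; used to integrate against them.\<close>

definition as_measure :: "'a::topological_space cmeasure \<Rightarrow> 'a measure" where
  "as_measure \<mu> = measure_of UNIV (sets borel) (\<lambda>A. ennreal (Re (\<mu> A)))"

definition point_mass :: "'a::topological_space \<Rightarrow> 'a cmeasure" where
  "point_mass x = (\<lambda>A. if A \<in> sets borel \<and> x \<in> A then 1 else 0)"

text \<open>Only meant for positive measures.\<close>

definition supp :: "'a::topological_space cmeasure \<Rightarrow> 'a set" where
  "supp \<mu> = {x. \<forall>U. open U \<and> x \<in> U \<longrightarrow> \<mu> U \<noteq> 0}"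

text \<open>The weak topology on the positive cone: the coarsest one making integration of every bounded
  continuous function continuous.\<close>

definition weak_topology :: "'a::topological_space cmeasure topology" where
  "weak_topology = topology_generated_by
     {{\<mu> \<in> positive_measures. (LINT x|as_measure \<mu>. f x) \<in> U} | (f :: 'a \<Rightarrow> real) U.
        continuous_on UNIV f \<and> bounded (range f) \<and> open U}"

text \<open>The Michael topology on the nonempty compact subsets.\<close>

definition michael_topology :: "'a::topological_space set topology" where
  "michael_topology = topology_generated_by
     {{K. compact K \<and> K \<noteq> {} \<and> K \<inter> U \<noteq> {} \<and> K \<subseteq> V} | U V. open U \<and> open V}"


section \<open>Hypergroups\<close>

locale hypergroup =
  fixes conv :: "'a::t2_space cmeasure \<Rightarrow> 'a cmeasure \<Rightarrow> 'a cmeasure"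
    and e :: 'a
    and tilde :: "'a \<Rightarrow> 'a"
  assumes locally_compact: "locally_compact_space (euclidean :: 'a topology)"
    and conv_closed: "\<lbrakk>\<mu> \<in> bounded_measures; \<nu> \<in> bounded_measures\<rbrakk> \<Longrightarrow> conv \<mu> \<nu> \<in> bounded_measures"
    and conv_linear_left:
      "\<lbrakk>\<mu> \<in> bounded_measures; \<nu> \<in> bounded_measures; \<rho> \<in> bounded_measures\<rbrakk> \<Longrightarrow>
         conv (\<lambda>A. a * \<mu> A + b * \<nu> A) \<rho> = (\<lambda>A. a * conv \<mu> \<rho> A + b * conv \<nu> \<rho> A)"
    and conv_linear_right:
      "\<lbrakk>\<mu> \<in> bounded_measures; \<nu> \<in> bounded_measures; \<rho> \<in> bounded_measures\<rbrakk> \<Longrightarrow>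
         conv \<rho> (\<lambda>A. a * \<mu> A + b * \<nu> A) = (\<lambda>A. a * conv \<rho> \<mu> A + b * conv \<rho> \<nu> A)"
    and conv_assoc:
      "\<lbrakk>\<mu> \<in> bounded_measures; \<nu> \<in> bounded_measures; \<rho> \<in> bounded_measures\<rbrakk> \<Longrightarrow>
         conv (conv \<mu> \<nu>) \<rho> = conv \<mu> (conv \<nu> \<rho>)"
    and conv_point_positive: "conv (point_mass x) (point_mass y) \<in> positive_measures"
    and conv_point_prob: "conv (point_mass x) (point_mass y) UNIV = 1"
    and conv_point_compact_supp: "compact (supp (conv (point_mass x) (point_mass y)))"
    and conv_weakly_continuous:
      "continuous_map (prod_topology weak_topology weak_topology) weak_topology (\<lambda>(\<mu>, \<nu>). conv \<mu> \<nu>)"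
    and supp_continuous:
      "continuous_map (euclidean :: ('a \<times> 'a) topology) michael_topology
         (\<lambda>(x, y). supp (conv (point_mass x) (point_mass y)))"
    and identity_left: "conv (point_mass e) (point_mass x) = point_mass x"
    and identity_right: "conv (point_mass x) (point_mass e) = point_mass x"
    and tilde_tilde: "tilde (tilde x) = x"
    and tilde_continuous: "continuous_on UNIV tilde"
    and conv_tilde:
      "(\<lambda>A. conv (point_mass x) (point_mass y) (tilde -` A)) =
         conv (point_mass (tilde y)) (point_mass (tilde x))"
    and identity_in_supp: "e \<in> supp (conv (point_mass x) (point_mass y)) \<longleftrightarrow> y = tilde x"

definition commutative_conv :: "('a::topological_space cmeasure \<Rightarrow> 'a cmeasure \<Rightarrow> 'a cmeasure) \<Rightarrow> bool" where
  "commutative_conv conv \<longleftrightarrow>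
     (\<forall>\<mu>\<in>bounded_measures. \<forall>\<nu>\<in>bounded_measures. conv \<mu> \<nu> = conv \<nu> \<mu>)"

abbreviation point_conv ::
  "('a::topological_space cmeasure \<Rightarrow> 'a cmeasure \<Rightarrow> 'a cmeasure) \<Rightarrow> 'a \<Rightarrow> 'a \<Rightarrow> 'a measure" where
  "point_conv conv x y \<equiv> as_measure (conv (point_mass x) (point_mass y))"

text \<open>Finiteness on compact sets makes the integrals of functions in C\<open>\<^sub>c\<close>(H) meaningful.\<close>

definition haar_measure ::
  "('a::topological_space cmeasure \<Rightarrow> 'a cmeasure \<Rightarrow> 'a cmeasure) \<Rightarrow> 'a measure \<Rightarrow> bool" where
  "haar_measure conv haar \<longleftrightarrow>
     sets haar = sets borel \<and>
     emeasure haar UNIV \<noteq> 0 \<and>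
     (\<forall>K. compact K \<longrightarrow> emeasure haar K < \<infinity>) \<and>
     (\<forall>x. \<forall>f :: 'a \<Rightarrow> complex. continuous_on UNIV f \<and> compact (closure {y. f y \<noteq> 0}) \<longrightarrow>
        (LINT y|haar. (LINT z|point_conv conv x y. f z)) = (LINT y|haar. f y))"


section \<open>Dual space, hyperdimension and Plancherel measure of a compact commutative hypergroup\<close>

definition dual ::
  "('a::topological_space cmeasure \<Rightarrow> 'a cmeasure \<Rightarrow> 'a cmeasure) \<Rightarrow> 'a \<Rightarrow> ('a \<Rightarrow> 'a) \<Rightarrow> ('a \<Rightarrow> complex) set" where
  "dual conv e tilde = {\<phi>. continuous_on UNIV \<phi> \<and> \<phi> e = 1 \<and> (\<forall>x. \<phi> (tilde x) = cnj (\<phi> x)) \<and>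
     (\<forall>x y. (LINT z|point_conv conv x y. \<phi> z) = \<phi> x * \<phi> y)}"

definition hyperdimension ::
  "('a::topological_space cmeasure \<Rightarrow> 'a cmeasure \<Rightarrow> 'a cmeasure) \<Rightarrow> 'a \<Rightarrow> ('a \<Rightarrow> 'a) \<Rightarrow> 'a measure \<Rightarrow>
     ('a \<Rightarrow> complex) \<Rightarrow> real" where
  "hyperdimension conv e tilde haar \<phi> = (THE k. 0 < k \<and>
     (\<forall>\<psi>\<in>dual conv e tilde.
        (LINT x|haar. \<phi> x * cnj (\<psi> x)) = (if \<psi> = \<phi> then complex_of_real (1 / k) else 0)))"

definition fourier :: "'a measure \<Rightarrow> ('a \<Rightarrow> complex) \<Rightarrow> ('a \<Rightarrow> complex) \<Rightarrow> complex" where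
  "fourier haar f \<phi> = (LINT x|haar. f x * cnj (\<phi> x))"

definition square_integrable :: "'b measure \<Rightarrow> ('b \<Rightarrow> complex) set" where
  "square_integrable M = {f \<in> borel_measurable M. integrable M (\<lambda>x. (norm (f x))\<^sup>2)}"

text \<open>
  The elements of the L\<open>\<^sup>2\<close>-spaces are represented by functions, which is why surjectivity is required
  up to equality almost everywhere.
\<close>

definition plancherel_measure ::
  "('a::topological_space cmeasure \<Rightarrow> 'a cmeasure \<Rightarrow> 'a cmeasure) \<Rightarrow> 'a \<Rightarrow> ('a \<Rightarrow> 'a) \<Rightarrow> 'a measure \<Rightarrow>
     ('a \<Rightarrow> complex) measure \<Rightarrow> bool" where
  "plancherel_measure conv e tilde haar planch \<longleftrightarrow>
     space planch = dual conv e tilde \<and>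
     sets planch = Pow (dual conv e tilde) \<and>
     (\<forall>f\<in>square_integrable haar.
        fourier haar f \<in> square_integrable planch \<and>
        (LINT \<phi>|planch. (norm (fourier haar f \<phi>))\<^sup>2) = (LINT x|haar. (norm (f x))\<^sup>2)) \<and>
     (\<forall>g\<in>square_integrable planch. \<exists>f\<in>square_integrable haar. AE \<phi> in planch. fourier haar f \<phi> = g \<phi>)"

end

theory Submission
  imports Defs
begin

text \<open>
  Once the characters are known to be pairwise orthogonal, the isometry applied to a character \<open>\<pi>\<close>, whose
  transform is \<open>\<parallel>\<pi>\<parallel>\<^sup>2\<close> times the indicator of \<open>\<pi>\<close>, gives \<open>\<parallel>\<pi>\<parallel>\<^sup>4 \<varpi>{\<pi>} = \<parallel>\<pi>\<parallel>\<^sup>2\<close>.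

  Orthogonality does not follow at once from the invariance of the Haar measure: the adjoint relation for
  translations is missing. Instead let \<open>k\<close> be a bump at \<open>e\<close> and let \<open>T y u\<close> be the integral of \<open>k\<close> with
  respect to \<open>\<delta>\<^sub>a * \<delta>\<^sub>y * \<delta>\<^sub>u\<close>. Integrating \<open>\<psi> y \<cdot> \<phi> u \<cdot> T y u\<close> over \<open>u\<close> first gives
  approximately \<open>(\<integral>k) \<cdot> cnj (\<phi> a) \<cdot> \<langle>\<psi>, \<phi>\<rangle>\<close>. Since \<open>T\<close> is symmetric in \<open>y\<close> and \<open>u\<close>, integrating over
  \<open>y\<close> first gives the same with \<open>\<phi>\<close> and \<open>\<psi>\<close> exchanged. Hence
  \<open>cnj (\<phi> a) \<cdot> \<langle>\<psi>, \<phi>\<rangle> = cnj (\<psi> a) \<cdot> \<langle>\<phi>, \<psi>\<rangle>\<close> for all \<open>a\<close>; taking \<open>a = e\<close> and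
  then an \<open>a\<close> with \<open>\<phi> a \<noteq> \<psi> a\<close> forces \<open>\<langle>\<psi>, \<phi>\<rangle> = 0\<close>.
\<close>

section \<open>Integration against measures in M(H)\<close>

text \<open>Countable additivity for the constant sequence of empty sets makes a constant series
  converge, so its term is 0.\<close>

lemma bounded_measures_empty:
  assumes "\<mu> \<in> bounded_measures"
  shows "\<mu> {} = 0"
proof -
  have "(\<lambda>n::nat. \<mu> {}) sums \<mu> (\<Union>n::nat. {})"
    using assms unfolding bounded_measures_def
    by (simp only: mem_Collect_eq, elim conjE) (drule spec[of _ "\<lambda>n. {}"], auto simp: disjoint_family_on_def)
  hence "(\<lambda>n::nat. \<mu> {}) \<longlonglongrightarrow> 0"
    using sums_summable summable_LIMSEQ_zero by blast
  thus ?thesis by (simp add: LIMSEQ_const_iff)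
qed

lemma bounded_measures_regular:
  assumes "\<mu> \<in> bounded_measures" "A \<in> sets borel" "\<epsilon> > 0"
  shows "\<exists>K. compact K \<and> K \<in> sets borel \<and> K \<subseteq> A \<and>
    (\<forall>B\<in>sets borel. B \<subseteq> A - K \<longrightarrow> norm (\<mu> B) < \<epsilon>)"
  using assms(1)[unfolded bounded_measures_def, THEN CollectD, THEN conjunct2, THEN conjunct2]
    assms(2,3) by simp

lemma positive_measuresD:
  assumes "\<mu> \<in> positive_measures"
  shows "\<mu> \<in> bounded_measures" "0 \<le> Re (\<mu> A)" "complex_of_real (Re (\<mu> A)) = \<mu> A"
  using assms by (auto simp: positive_measures_def complex_nonneg_Reals_iff complex_eq_iff)

lemma space_as_measure [simp]: "space (as_measure \<mu>) = UNIV"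
  unfolding as_measure_def by (simp add: space_measure_of_conv)

lemma sets_as_measure [simp, measurable_cong]: "sets (as_measure \<mu>) = sets borel"
proof -
  have "sigma_sets UNIV (sets (borel :: 'a measure)) = sets borel"
    by (metis sets.sigma_sets_eq space_borel)
  thus ?thesis unfolding as_measure_def by (simp add: sets_measure_of_conv)
qed

text \<open>\<open>measure_of\<close> yields the zero measure when its set function is not a
  measure, so no value can be read off before countable additivity has been checked; it is inherited
  from \<open>\<mu>\<close> through real parts.\<close>

lemma emeasure_as_measure:
  assumes "\<mu> \<in> positive_measures" "A \<in> sets borel"
  shows "emeasure (as_measure \<mu>) A = ennreal (Re (\<mu> A))"
  unfolding as_measure_def
proof (rule emeasure_measure_of_sigma)
  show "sigma_algebra UNIV (sets (borel :: 'a measure))"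
    by (metis sets.sigma_algebra_axioms space_borel)
  show "positive (sets borel) (\<lambda>A. ennreal (Re (\<mu> A)))"
    using bounded_measures_empty[OF positive_measuresD(1)[OF assms(1)]] by (simp add: positive_def)
  show "countably_additive (sets borel) (\<lambda>A. ennreal (Re (\<mu> A)))"
  proof (rule countably_additiveI)
    fix A :: "nat \<Rightarrow> 'a set" assume A: "range A \<subseteq> sets borel" "disjoint_family A"
    have "(\<lambda>n. \<mu> (A n)) sums \<mu> (\<Union>n. A n)"
      using positive_measuresD(1)[OF assms(1)] A unfolding bounded_measures_def by blast
    hence "(\<lambda>n. Re (\<mu> (A n))) sums Re (\<mu> (\<Union>n. A n))" by (rule sums_Re)
    thus "(\<Sum>i. ennreal (Re (\<mu> (A i)))) = ennreal (Re (\<mu> (\<Union>i. A i)))"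
      by (intro suminf_ennreal_eq) (use positive_measuresD(2)[OF assms(1)] in auto)
  qed
  show "A \<in> sets borel" by fact
qed

lemma finite_measure_as_measure:
  "\<mu> \<in> positive_measures \<Longrightarrow> finite_measure (as_measure \<mu>)"
  by (rule finite_measureI) (simp add: emeasure_as_measure)

lemma measure_as_measure:
  "\<mu> \<in> positive_measures \<Longrightarrow> A \<in> sets borel \<Longrightarrow> measure (as_measure \<mu>) A = Re (\<mu> A)"
  by (simp add: measure_def emeasure_as_measure positive_measuresD(2))

section \<open>Linear combinations and point masses in M(H)\<close>

lemma bounded_measures_lincomb:
  fixes \<mu> \<nu> :: "'a::t2_space cmeasure"
  assumes "\<mu> \<in> bounded_measures" "\<nu> \<in> bounded_measures"
  shows "(\<lambda>A. a * \<mu> A + b * \<nu> A) \<in> bounded_measures"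
  unfolding bounded_measures_def
proof (intro CollectI conjI allI impI ballI)
  fix A :: "'a set" assume "A \<notin> sets borel"
  then show "a * \<mu> A + b * \<nu> A = 0" using assms by (auto simp: bounded_measures_def)
next
  fix A :: "nat \<Rightarrow> 'a set" assume A: "range A \<subseteq> sets borel" "disjoint_family A"
  have "(\<lambda>n. \<mu> (A n)) sums \<mu> (\<Union>n. A n)" "(\<lambda>n. \<nu> (A n)) sums \<nu> (\<Union>n. A n)"
    using assms A unfolding bounded_measures_def by blast+
  then show "(\<lambda>n. a * \<mu> (A n) + b * \<nu> (A n)) sums (a * \<mu> (\<Union> (range A)) + b * \<nu> (\<Union> (range A)))"
    by (intro sums_add sums_mult)
next
  fix A :: "'a set" and \<epsilon> :: real assume A: "A \<in> sets borel" and e: "\<epsilon> > 0"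
  \<comment> \<open>The summand 1 keeps the denominator positive when both coefficients vanish and
    makes the final estimate strict.\<close>
  define \<delta> where "\<delta> = \<epsilon> / (norm a + norm b + 1)"
  have pos: "norm a + norm b + 1 > 0" by (smt (verit) norm_ge_zero)
  have d: "\<delta> > 0" using e pos by (simp add: \<delta>_def)
  obtain K1 where K1: "compact K1" "K1 \<in> sets borel" "K1 \<subseteq> A"
     "\<forall>B\<in>sets borel. B \<subseteq> A - K1 \<longrightarrow> norm (\<mu> B) < \<delta>"
    using bounded_measures_regular[OF assms(1) A d] by (elim exE conjE)
  obtain K2 where K2: "compact K2" "K2 \<in> sets borel" "K2 \<subseteq> A"
     "\<forall>B\<in>sets borel. B \<subseteq> A - K2 \<longrightarrow> norm (\<nu> B) < \<delta>"
    using bounded_measures_regular[OF assms(2) A d] by (elim exE conjE)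
  have "norm (a * \<mu> B + b * \<nu> B) < \<epsilon>" if B: "B \<in> sets borel" "B \<subseteq> A - (K1 \<union> K2)" for B
  proof -
    have "norm (\<mu> B) < \<delta>" "norm (\<nu> B) < \<delta>" using K1(4) K2(4) B by blast+
    then have "norm (a * \<mu> B) \<le> norm a * \<delta>" "norm (b * \<nu> B) \<le> norm b * \<delta>"
      by (auto simp: norm_mult intro!: mult_left_mono)
    then have "norm (a * \<mu> B + b * \<nu> B) \<le> norm a * \<delta> + norm b * \<delta>"
      by (meson add_mono norm_triangle_le)
    also have "\<dots> < (norm a + norm b + 1) * \<delta>" using d by (simp add: algebra_simps)
    also have "\<dots> = \<epsilon>" using pos by (simp add: \<delta>_def)
    finally show ?thesis .
  qed
  then show "\<exists>K. compact K \<and> K \<in> sets borel \<and> K \<subseteq> A \<and>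
      (\<forall>B\<in>sets borel. B \<subseteq> A - K \<longrightarrow> norm (a * \<mu> B + b * \<nu> B) < \<epsilon>)"
    using K1(1-3) K2(1-3)
    by (intro exI[of _ "K1 \<union> K2"] conjI ballI impI compact_Un sets.Un Un_least) assumption+
qed

lemma positive_measures_lincomb:
  fixes \<mu> \<nu> :: "'a::t2_space cmeasure"
  assumes "\<mu> \<in> positive_measures" "\<nu> \<in> positive_measures" "0 \<le> a" "0 \<le> b"
  shows "(\<lambda>A. of_real a * \<mu> A + of_real b * \<nu> A) \<in> positive_measures"
  using assms bounded_measures_lincomb[of \<mu> \<nu> "of_real a" "of_real b"]
  by (auto simp: positive_measures_def complex_nonneg_Reals_iff)

lemma zero_positive_measure: "(\<lambda>A. 0) \<in> (positive_measures :: 'a::t2_space cmeasure set)"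
  by (auto simp: positive_measures_def bounded_measures_def intro!: exI[of _ "{}"])

lemma point_mass_positive: "point_mass x \<in> (positive_measures :: 'a::t2_space cmeasure set)"
proof -
  have "(\<lambda>n. point_mass x (A n)) sums point_mass x (\<Union>n. A n)"
    if A: "range A \<subseteq> sets borel" "disjoint_family A" for A :: "nat \<Rightarrow> 'a set"
  proof (cases "\<exists>m. x \<in> A m")
    case True
    then obtain m where m: "x \<in> A m" by blast
    have "(\<lambda>n. point_mass x (A n)) = (\<lambda>n. if n = m then 1 else 0)"
      using A m by (fastforce simp: point_mass_def disjoint_family_on_def)
    moreover have "point_mass x (\<Union>n. A n) = 1" using A m by (auto simp: point_mass_def)
    ultimately show ?thesis using sums_single[of m "\<lambda>_. 1::complex"] by simp
  next
    case False
    then show ?thesis by (simp add: point_mass_def)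
  qed
  \<comment> \<open>The compact set is \<open>{x}\<close> or empty, chosen so that no Borel subset
    of \<open>A - K\<close> contains \<open>x\<close>.\<close>
  moreover have "\<exists>K. compact K \<and> K \<in> sets borel \<and> K \<subseteq> A \<and>
      (\<forall>B\<in>sets borel. B \<subseteq> A - K \<longrightarrow> norm (point_mass x B) < \<epsilon>)" if "\<epsilon> > 0" for A \<epsilon>
    using that by (intro exI[of _ "if x \<in> A then {x} else {}"]) (auto simp: point_mass_def)
  ultimately show ?thesis
    by (auto simp: positive_measures_def bounded_measures_def) (auto simp: point_mass_def)
qed

section \<open>Linearity of the integral in the measure\<close>

lemma nn_integral_lincomb_measure:
  assumes "sets M1 = sets M" "sets M2 = sets M"
    and "\<And>A. A \<in> sets M \<Longrightarrow> emeasure M A = a * emeasure M1 A + b * emeasure M2 A"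
    and "f \<in> borel_measurable M"
  shows "nn_integral M f = a * nn_integral M1 f + b * nn_integral M2 f"
  using assms(4)
proof (induction rule: borel_measurable_induct)
  case (cong f g)
  then show ?case
    by (metis assms(1,2) nn_integral_cong sets_eq_imp_space_eq)
next
  case (set A)
  then show ?case using assms by simp
next
  case (mult u c)
  then have "u \<in> borel_measurable M1" "u \<in> borel_measurable M2"
    using assms(1,2) measurable_cong_sets by blast+
  with mult show ?case by (simp add: nn_integral_cmult algebra_simps)
next
  case (add u v)
  then have "u \<in> borel_measurable M1" "u \<in> borel_measurable M2" "v \<in> borel_measurable M1" "v \<in> borel_measurable M2"
    using assms(1,2) measurable_cong_sets by blast+
  with add show ?case by (simp add: nn_integral_add algebra_simps)
next
  case (seq U)
  have m: "U i \<in> borel_measurable M1" "U i \<in> borel_measurable M2" for i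
    using assms(1,2) measurable_cong_sets seq(1) by blast+
  have inc: "incseq (\<lambda>i. c * integral\<^sup>N N (U i))" for c N
    using seq(3) by (auto simp: incseq_def le_fun_def intro!: mult_left_mono nn_integral_mono)
  \<comment> \<open>Monotone convergence, used for all three measures; the induction rule forms a
    supremum of functions, which is first rewritten pointwise.\<close>
  have *: "integral\<^sup>N N (Sup (range U)) = (SUP i. integral\<^sup>N N (U i))" if "\<And>i. U i \<in> borel_measurable N" for N
  proof -
    have "integral\<^sup>N N (Sup (range U)) = (\<integral>\<^sup>+x. (SUP i. U i x) \<partial>N)"
      by (rule nn_integral_cong) (simp add: SUP_apply image_comp)
    also have "\<dots> = (SUP i. integral\<^sup>N N (U i))" by (rule nn_integral_monotone_convergence_SUP[OF seq(3) that])
    finally show ?thesis .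
  qed
  have "integral\<^sup>N M (U i) = a * integral\<^sup>N M1 (U i) + b * integral\<^sup>N M2 (U i)" for i
    using seq by blast
  then show ?case
    unfolding *[OF seq(1)] *[OF m(1)] *[OF m(2)]
    by (simp add: SUP_mult_left_ennreal ennreal_SUP_add inc)
qed

lemma integral_lincomb_measure:
  fixes f :: "'a \<Rightarrow> real"
  assumes "sets M1 = sets M" "sets M2 = sets M" "0 \<le> a" "0 \<le> b"
    and "\<And>A. A \<in> sets M \<Longrightarrow> emeasure M A = ennreal a * emeasure M1 A + ennreal b * emeasure M2 A"
    and "integrable M f" "integrable M1 f" "integrable M2 f"
  shows "integral\<^sup>L M f = a * integral\<^sup>L M1 f + b * integral\<^sup>L M2 f"
proof -
  have f: "f \<in> borel_measurable M" using assms(6) by blast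
  \<comment> \<open>\<open>ennreal\<close> truncates negative reals to 0, so the two choices of
    \<open>g\<close> yield the positive and the negative part of \<open>f\<close>.\<close>
  have "enn2real (\<integral>\<^sup>+x. ennreal (g x) \<partial>M) =
      a * enn2real (\<integral>\<^sup>+x. ennreal (g x) \<partial>M1) + b * enn2real (\<integral>\<^sup>+x. ennreal (g x) \<partial>M2)"
    if "g = f \<or> g = (\<lambda>x. - f x)" for g
  proof -
    have "(\<integral>\<^sup>+x. ennreal (g x) \<partial>N) < \<infinity>" if "integrable N f" for N
    proof -
      have "integrable N g" using that \<open>g = f \<or> g = (\<lambda>x. - f x)\<close> by auto
      then show ?thesis 
        using nn_integral_mono[of N "\<lambda>x. ennreal (g x)" "\<lambda>x. ennreal (norm (g x))", OF ennreal_leI]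
        by (simp add: integrable_iff_bounded abs_ge_self) (meson le_less_trans)
    qed
    then have fin: "(\<integral>\<^sup>+x. ennreal (g x) \<partial>M1) < \<infinity>" "(\<integral>\<^sup>+x. ennreal (g x) \<partial>M2) < \<infinity>" using assms by auto
    have g: "(\<lambda>x. ennreal (g x)) \<in> borel_measurable M" using that f by auto
    have "(\<integral>\<^sup>+x. ennreal (g x) \<partial>M) =
        ennreal a * (\<integral>\<^sup>+x. ennreal (g x) \<partial>M1) + ennreal b * (\<integral>\<^sup>+x. ennreal (g x) \<partial>M2)"
      by (rule nn_integral_lincomb_measure[OF assms(1,2,5) g])
    then show ?thesis using fin assms(3,4)
      by (simp add: enn2real_plus enn2real_mult ennreal_mult_less_top)
  qed
  from this[of f] this[of "\<lambda>x. - f x"] assms(6-8) show ?thesis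
    by (simp add: real_lebesgue_integral_def algebra_simps)
qed

lemma integrable_as_measure:
  fixes f :: "'a::topological_space \<Rightarrow> 'b::{second_countable_topology, banach}"
  assumes "\<mu> \<in> positive_measures" "continuous_on UNIV f" "bounded (range f)"
  shows "integrable (as_measure \<mu>) f"
proof -
  interpret finite_measure "as_measure \<mu>" by (rule finite_measure_as_measure) fact
  obtain B where "\<And>x. norm (f x) \<le> B" using assms(3) by (auto simp: bounded_iff)
  then show ?thesis
    by (intro integrable_const_bound[of _ B] AE_I2)
      (auto simp: measurable_cong_sets[OF sets_as_measure refl] intro: borel_measurable_continuous_onI assms(2))
qed

lemma integral_as_measure_lincomb:
  fixes f :: "'a::t2_space \<Rightarrow> real"
  assumes "\<mu> \<in> positive_measures" "\<nu> \<in> positive_measures" "0 \<le> a" "0 \<le> b"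
    "continuous_on UNIV f" "bounded (range f)"
  shows "(LINT x|as_measure (\<lambda>A. of_real a * \<mu> A + of_real b * \<nu> A). f x) =
    a * (LINT x|as_measure \<mu>. f x) + b * (LINT x|as_measure \<nu>. f x)"
  by (rule integral_lincomb_measure)
    (use assms in \<open>auto simp: emeasure_as_measure positive_measures_lincomb positive_measuresD
       ennreal_plus ennreal_mult intro!: integrable_as_measure\<close>)

lemma integral_as_measure_zero:
  fixes f :: "'a::t2_space \<Rightarrow> real"
  shows "(LINT x|as_measure (\<lambda>A. 0). f x) = 0"
proof -
  have "AE x in as_measure (\<lambda>A::'a set. 0). False"
    by (rule AE_I[of _ _ UNIV]) (auto simp: emeasure_as_measure zero_positive_measure)
  then show ?thesis by (intro integral_eq_zero_AE) auto
qed

lemma integral_point_mass: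
  fixes f :: "'a::t2_space \<Rightarrow> 'b::{second_countable_topology, banach}"
  assumes "continuous_on UNIV f"
  shows "(LINT y|as_measure (point_mass x). f y) = f x"
proof -
  have "AE y in as_measure (point_mass x). y \<in> {x}"
    by (rule AE_I[of _ _ "-{x}"])
      (auto simp: emeasure_as_measure[OF point_mass_positive], simp add: point_mass_def)
  then have "(LINT y|as_measure (point_mass x). f y) = (LINT y|as_measure (point_mass x). f x)"
    by (intro integral_cong_AE) (auto simp: measurable_cong_sets[OF sets_as_measure refl] intro: borel_measurable_continuous_onI assms)
  also have "\<dots> = f x"
    by (simp add: measure_as_measure[OF point_mass_positive], simp add: point_mass_def)
  finally show ?thesis .
qed

text \<open>The complement of the support is a union of possibly uncountably many null open sets, so
  countable additivity alone does not make it null. Inner regularity does: a compact part is covered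
  by finitely many of these sets, and the rest has mass below any \<open>\<epsilon>\<close>.\<close>

lemma measure_compl_supp:
  fixes \<mu> :: "'a::t2_space cmeasure"
  assumes "\<mu> \<in> positive_measures"
  shows "emeasure (as_measure \<mu>) (- supp \<mu>) = 0" "closed (supp \<mu>)"
proof -
  have *: "- supp \<mu> = \<Union>{U. open U \<and> \<mu> U = 0}" by (auto simp: supp_def)
  have op: "open (- supp \<mu>)" unfolding * by auto
  then show cl: "closed (supp \<mu>)" by (simp add: closed_def)
  have "Re (\<mu> (- supp \<mu>)) \<le> \<epsilon>" if eps: "\<epsilon> > 0" for \<epsilon>
  proof -
    obtain K where K: "compact K" "K \<in> sets borel" "K \<subseteq> - supp \<mu>"
      "\<forall>B\<in>sets borel. B \<subseteq> - supp \<mu> - K \<longrightarrow> norm (\<mu> B) < \<epsilon>"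
      using bounded_measures_regular[OF positive_measuresD(1)[OF assms] borel_open[OF op] eps]
      by (elim exE conjE)
    obtain \<C> where C: "finite \<C>" "\<C> \<subseteq> {U. open U \<and> \<mu> U = 0}" "K \<subseteq> \<Union>\<C>"
      by (rule compactE[OF K(1) K(3)[unfolded *]]) (simp, rule that)
    have "emeasure (as_measure \<mu>) (\<Union>U\<in>\<C>. U) \<le> (\<Sum>U\<in>\<C>. emeasure (as_measure \<mu>) U)"
      by (rule emeasure_subadditive_finite[OF C(1)]) (use C(2) in \<open>auto intro: borel_open\<close>)
    also have "\<dots> = 0"
      using C(2) by (auto intro!: sum.neutral simp: emeasure_as_measure[OF assms] subset_eq)
    finally have "emeasure (as_measure \<mu>) (\<Union>\<C>) = 0" by simp
    moreover have "emeasure (as_measure \<mu>) K \<le> emeasure (as_measure \<mu>) (\<Union>\<C>)"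
      by (rule emeasure_mono) (use C in \<open>auto intro!: borel_open\<close>)
    ultimately have "emeasure (as_measure \<mu>) K = 0" by simp
    moreover have "emeasure (as_measure \<mu>) (- supp \<mu>) =
        emeasure (as_measure \<mu>) K + emeasure (as_measure \<mu>) (- supp \<mu> - K)"
      using K op by (subst plus_emeasure) (auto intro!: arg_cong[where f = "emeasure _"])
    moreover have "norm (\<mu> (- supp \<mu> - K)) < \<epsilon>" using K op by auto
    ultimately show ?thesis
      using op K(2) complex_Re_le_cmod[of "\<mu> (- supp \<mu> - K)"]
      by (simp add: emeasure_as_measure assms positive_measuresD)
  qed
  then have "Re (\<mu> (- supp \<mu>)) \<le> 0" by (rule field_le_epsilon) simp
  then show "emeasure (as_measure \<mu>) (- supp \<mu>) = 0"
    using op by (simp add: emeasure_as_measure assms ennreal_neg)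
qed

section \<open>The weak topology\<close>

lemma topspace_weak_topology:
  "topspace weak_topology = (positive_measures :: 'a::t2_space cmeasure set)"
proof -
  let ?B = "{{\<mu> \<in> positive_measures. (LINT x|as_measure \<mu>. f x) \<in> U} | (f :: 'a \<Rightarrow> real) U.
        continuous_on UNIV f \<and> bounded (range f) \<and> open U}"
  \<comment> \<open>The zero function with \<open>U = UNIV\<close> imposes no condition, so the
    whole cone is one of the generating sets.\<close>
  have "positive_measures \<in> ?B"
    by (intro CollectI exI[of _ "\<lambda>_. 0"] exI[of _ UNIV]) auto
  then have "\<Union>?B = positive_measures" by blast
  then show ?thesis by (simp add: weak_topology_def)
qed

lemma continuous_map_weak_integral:
  fixes f :: "'a::t2_space \<Rightarrow> real"
  assumes "continuous_on UNIV f" "bounded (range f)"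
  shows "continuous_map weak_topology euclideanreal (\<lambda>\<mu>. LINT x|as_measure \<mu>. f x)"
proof -
  have "openin weak_topology {\<mu> \<in> positive_measures. (LINT x|as_measure \<mu>. f x) \<in> U}" if "open U" for U
    unfolding weak_topology_def
    by (rule topology_generated_by_Basis) (use assms that in auto)
  then show ?thesis
    by (auto simp: continuous_map topspace_weak_topology)
qed

text \<open>Integration against a point mass is evaluation, so a generating weakly open set pulls
  back to the preimage of \<open>U\<close> under \<open>f\<close>.\<close>

lemma continuous_map_point_mass:
  "continuous_map euclidean weak_topology (point_mass :: 'a::t2_space \<Rightarrow> 'a cmeasure)"
  unfolding weak_topology_def
proof (rule continuous_on_generated_topo)
  fix V assume "V \<in> {{\<mu> \<in> positive_measures. (LINT x|as_measure \<mu>. f x) \<in> U} | (f :: 'a \<Rightarrow> real) U.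
        continuous_on UNIV f \<and> bounded (range f) \<and> open U}"
  then obtain f :: "'a \<Rightarrow> real" and U where V: "V = {\<mu> \<in> positive_measures. (LINT x|as_measure \<mu>. f x) \<in> U}"
    "continuous_on UNIV f" "open U" by auto
  have "point_mass -` V = f -` U"
    using V(2) by (auto simp: V(1) point_mass_positive integral_point_mass)
  then show "openin euclidean (point_mass -` V \<inter> topspace euclidean)"
    using V(2,3) by (simp add: open_vimage)
next
  show "point_mass ` topspace euclidean \<subseteq> \<Union> {{\<mu> \<in> positive_measures. (LINT x|as_measure \<mu>. f x) \<in> U} | (f :: 'a \<Rightarrow> real) U.
        continuous_on UNIV f \<and> bounded (range f) \<and> open U}"
    using topspace_weak_topology[where 'a='a] point_mass_positive
    unfolding weak_topology_def by auto
qed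

text \<open>The generating sets form only a subbase. Induction over the generated topology brings
  any neighbourhood down to finitely many test functions and one tolerance, the form needed for
  approximation by point masses.\<close>

lemma weak_neighbourhood:
  fixes \<mu> :: "'a::t2_space cmeasure"
  assumes "openin weak_topology W" "\<mu> \<in> W"
  shows "\<exists>(G :: ('a \<Rightarrow> real) set) \<delta>. finite G \<and> \<delta> > 0 \<and>
    (\<forall>g\<in>G. continuous_on UNIV g \<and> bounded (range g)) \<and>
    (\<forall>\<nu>\<in>positive_measures. (\<forall>g\<in>G. \<bar>(LINT x|as_measure \<nu>. g x) - (LINT x|as_measure \<mu>. g x)\<bar> < \<delta>) \<longrightarrow> \<nu> \<in> W)"
proof -
  have "generate_topology_on {{\<mu> \<in> positive_measures. (LINT x|as_measure \<mu>. f x) \<in> U} | (f :: 'a \<Rightarrow> real) U.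
        continuous_on UNIV f \<and> bounded (range f) \<and> open U} W"
    using assms(1) unfolding weak_topology_def by (rule openin_topology_generated_by)
  then show ?thesis using assms(2)
  proof (induction rule: generate_topology_on.induct)
    case Empty
    then show ?case by simp
  next
    case (Int a b)
    have "\<mu> \<in> a" "\<mu> \<in> b" using Int.prems by auto
    note ih = Int.IH(1)[OF this(1)] Int.IH(2)[OF this(2)]
    obtain G :: "('a \<Rightarrow> real) set" and d where G: "finite G" "d > 0" "\<forall>g\<in>G. continuous_on UNIV g \<and> bounded (range g)"
      "\<forall>\<nu>\<in>positive_measures. (\<forall>g\<in>G. \<bar>(LINT x|as_measure \<nu>. g x) - (LINT x|as_measure \<mu>. g x)\<bar> < d) \<longrightarrow> \<nu> \<in> a"
      using ih(1) by (elim exE conjE) (rule that, assumption+)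
    obtain G' :: "('a \<Rightarrow> real) set" and d' where G': "finite G'" "d' > 0" "\<forall>g\<in>G'. continuous_on UNIV g \<and> bounded (range g)"
      "\<forall>\<nu>\<in>positive_measures. (\<forall>g\<in>G'. \<bar>(LINT x|as_measure \<nu>. g x) - (LINT x|as_measure \<mu>. g x)\<bar> < d') \<longrightarrow> \<nu> \<in> b"
      using ih(2) by (elim exE conjE) (rule that, assumption+)
    show ?case
      by (rule exI[of _ "G \<union> G'"], rule exI[of _ "min d d'"]) (use G G' in \<open>simp add: ball_Un\<close>)
  next
    case (UN K)
    then obtain k where k: "k \<in> K" "\<mu> \<in> k" by blast
    then show ?case using UN.IH[OF k] by (metis UnionI)
  next
    case (Basis s)
    then obtain f :: "'a \<Rightarrow> real" and U where s: "s = {\<mu> \<in> positive_measures. (LINT x|as_measure \<mu>. f x) \<in> U}"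
      "continuous_on UNIV f" "bounded (range f)" "open U" by auto
    then obtain d where d: "d > 0" "\<And>y. \<bar>y - (LINT x|as_measure \<mu>. f x)\<bar> < d \<Longrightarrow> y \<in> U"
      using Basis(2) by (auto simp: open_dist dist_real_def)
    show ?case
      by (rule exI[of _ "{f}"], rule exI[of _ d]) (use s d in simp)
  qed
qed

section \<open>Weak density of finite combinations of point masses\<close>

inductive_set discrete_measures :: "'a::topological_space cmeasure set" where
  zero: "(\<lambda>A. 0) \<in> discrete_measures"
| add: "\<nu> \<in> discrete_measures \<Longrightarrow> 0 \<le> c \<Longrightarrow>
    (\<lambda>A. of_real 1 * \<nu> A + of_real c * point_mass x A) \<in> discrete_measures"

lemma discrete_measures_positive:
  "\<nu> \<in> discrete_measures \<Longrightarrow> \<nu> \<in> (positive_measures :: 'a::t2_space cmeasure set)"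
  by (induction rule: discrete_measures.induct)
    (blast intro: zero_positive_measure positive_measures_lincomb point_mass_positive zero_le_one)+

text \<open>A Riemann sum: every \<open>g\<close> in \<open>G\<close> varies by at most
  \<open>\<delta>\<close> on a piece of \<open>\<N>\<close>, so the mass there may be moved to a
  single point. The induction strips one piece \<open>N\<close> from \<open>B\<close>, leaving
  \<open>B - N\<close> to the others; a bound proportional to mass adds up over the disjoint
  parts.\<close>

lemma discrete_approximation_on:
  fixes \<mu> :: "'a::t2_space cmeasure"
  assumes \<mu>: "\<mu> \<in> positive_measures"
    and G: "\<And>g::'a \<Rightarrow> real. g \<in> G \<Longrightarrow> continuous_on UNIV g \<and> bounded (range g)"
    and "finite \<N>" "\<And>N. N \<in> \<N> \<Longrightarrow> N \<in> sets borel \<and> (\<forall>g\<in>G. \<forall>x\<in>N. \<forall>y\<in>N. \<bar>g x - g y\<bar> \<le> \<delta>)"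
    and "B \<in> sets borel" "B \<subseteq> \<Union>\<N>"
  shows "\<exists>\<nu>\<in>discrete_measures. \<forall>g\<in>G.
    \<bar>(LINT x|as_measure \<nu>. g x) - (LINT x|as_measure \<mu>. indicat_real B x * g x)\<bar> \<le> \<delta> * measure (as_measure \<mu>) B"
  using assms(3-)
proof (induction \<N> arbitrary: B rule: finite_induct)
  case empty
  then show ?case
    by (intro bexI[of _ "\<lambda>A. 0"]) (auto simp: integral_as_measure_zero discrete_measures.zero)
next
  case (insert N \<N>)
  interpret finite_measure "as_measure \<mu>" by (rule finite_measure_as_measure) fact
  have N: "N \<in> sets borel" "\<And>g x y. g \<in> G \<Longrightarrow> x \<in> N \<Longrightarrow> y \<in> N \<Longrightarrow> \<bar>g x - g y\<bar> \<le> \<delta>"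
    using insert.prems(1) by auto
  obtain \<nu> where \<nu>: "\<nu> \<in> discrete_measures" "\<And>g. g \<in> G \<Longrightarrow>
      \<bar>(LINT x|as_measure \<nu>. g x) - (LINT x|as_measure \<mu>. indicat_real (B - N) x * g x)\<bar>
        \<le> \<delta> * measure (as_measure \<mu>) (B - N)"
  proof -
    have "B - N \<in> sets borel" "B - N \<subseteq> \<Union>\<N>" using insert.prems N by auto
    from insert.IH[OF insert.prems(1) this] that show thesis by blast
  qed
  have meas: "measure (as_measure \<mu>) B = measure (as_measure \<mu>) (B - N) + measure (as_measure \<mu>) (B \<inter> N)"
    using insert.prems(2) N(1)
    by (subst finite_measure_Union[symmetric]) (auto intro!: arg_cong[where f="measure _"])
  \<comment> \<open>The alternative with a constant covers the factors \<open>g p\<close> and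
    \<open>\<delta>\<close> that occur below.\<close>
  have int: "integrable (as_measure \<mu>) (\<lambda>x. indicat_real C x * g x)"
    if "g \<in> G \<or> g = (\<lambda>_. r)" "C \<in> sets borel" for C g r
    using integrable_as_measure[OF \<mu>, of g] G[of g] that
    by (intro integrable_mult_indicator[where 'b = real, unfolded real_scaleR_def]) auto
  show ?case
  proof (cases "N = {}")
    case True
    then show ?thesis using \<nu> by (intro bexI[of _ \<nu>]) auto
  next
    case False
    then obtain p where p: "p \<in> N" by blast
    \<comment> \<open>The mass of \<open>B \<inter> N\<close> is placed at the sample point
      \<open>p\<close>.\<close>
    define c where "c = measure (as_measure \<mu>) (B \<inter> N)"
    define \<nu>' where "\<nu>' = (\<lambda>A. of_real 1 * \<nu> A + of_real c * point_mass p A)"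
    have "\<nu>' \<in> discrete_measures" unfolding \<nu>'_def by (intro discrete_measures.add \<nu>) (simp add: c_def)
    moreover have "\<bar>(LINT x|as_measure \<nu>'. g x) - (LINT x|as_measure \<mu>. indicat_real B x * g x)\<bar>
        \<le> \<delta> * measure (as_measure \<mu>) B" if g: "g \<in> G" for g
    proof -
      have 1: "(LINT x|as_measure \<nu>'. g x) = (LINT x|as_measure \<nu>. g x) + c * g p"
        unfolding \<nu>'_def
        by (subst integral_as_measure_lincomb)
          (use \<nu> G[OF g] in \<open>auto simp: discrete_measures_positive point_mass_positive integral_point_mass c_def\<close>)
      have 2: "(LINT x|as_measure \<mu>. indicat_real B x * g x) =
          (LINT x|as_measure \<mu>. indicat_real (B - N) x * g x) + (LINT x|as_measure \<mu>. indicat_real (B \<inter> N) x * g x)"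
        using insert.prems(2) N(1) g
        by (subst Bochner_Integration.integral_add[symmetric])
          (auto intro!: int[where r = 0] Bochner_Integration.integral_cong simp del: mult_cancel_right split: split_indicator)
      have "c * g p = (LINT x|as_measure \<mu>. indicat_real (B \<inter> N) x * g p)"
        using insert.prems(2) N(1) by (simp add: c_def)
      then have "c * g p - (LINT x|as_measure \<mu>. indicat_real (B \<inter> N) x * g x) =
          (LINT x|as_measure \<mu>. indicat_real (B \<inter> N) x * g p) - (LINT x|as_measure \<mu>. indicat_real (B \<inter> N) x * g x)"
        by simp
      also have "\<dots> = (LINT x|as_measure \<mu>. indicat_real (B \<inter> N) x * g p - indicat_real (B \<inter> N) x * g x)"
        using insert.prems(2) N(1) g
        by (intro Bochner_Integration.integral_diff[symmetric] int) auto
      also have "\<dots> = (LINT x|as_measure \<mu>. indicat_real (B \<inter> N) x * (g p - g x))"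
        by (simp only: right_diff_distrib)
      also have "\<bar>\<dots>\<bar> \<le> (LINT x|as_measure \<mu>. indicat_real (B \<inter> N) x * \<delta>)"
      proof (rule order_trans[OF integral_abs_bound integral_mono])
        have "integrable (as_measure \<mu>) (\<lambda>x. indicat_real (B \<inter> N) x * (g p - g x))"
          using insert.prems(2) N(1) g unfolding right_diff_distrib
          by (intro Bochner_Integration.integrable_diff int) auto
        then show "integrable (as_measure \<mu>) (\<lambda>x. \<bar>indicat_real (B \<inter> N) x * (g p - g x)\<bar>)" by simp
        show "integrable (as_measure \<mu>) (\<lambda>x. indicat_real (B \<inter> N) x * \<delta>)"
          using insert.prems(2) N(1) by (intro int) auto
        show "\<bar>indicat_real (B \<inter> N) x * (g p - g x)\<bar> \<le> indicat_real (B \<inter> N) x * \<delta>" for x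
          using N(2)[OF g p] by (auto simp: indicator_def)
      qed
      also have "\<dots> = \<delta> * c" using insert.prems(2) N(1) by (simp add: c_def)
      finally show ?thesis
        using \<nu>(2)[OF g] 1 2 meas unfolding c_def by (simp add: algebra_simps)
    qed
    ultimately show ?thesis by blast
  qed
qed

text \<open>Compactness supplies a finite cover by open sets on which the finitely many test
  functions vary little; the Riemann sum for this cover is the required measure.\<close>

lemma discrete_approximation:
  fixes \<mu> :: "'a::t2_space cmeasure"
  assumes cpt: "compact (UNIV :: 'a set)" and \<mu>: "\<mu> \<in> positive_measures"
    and G: "finite G" "\<And>g::'a \<Rightarrow> real. g \<in> G \<Longrightarrow> continuous_on UNIV g \<and> bounded (range g)" and "\<epsilon> > 0"
  shows "\<exists>\<nu>\<in>discrete_measures. \<forall>g\<in>G. \<bar>(LINT x|as_measure \<nu>. g x) - (LINT x|as_measure \<mu>. g x)\<bar> < \<epsilon>"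
proof -
  \<comment> \<open>Dividing by the total mass plus 1 makes the error bound strictly smaller than
    \<open>\<epsilon>\<close>, also when the total mass is 0.\<close>
  define \<delta> where "\<delta> = \<epsilon> / (measure (as_measure \<mu>) UNIV + 1)"
  have m: "measure (as_measure \<mu>) UNIV + 1 > 0" by (smt (verit) measure_nonneg)
  have \<delta>: "\<delta> > 0" using \<open>\<epsilon> > 0\<close> m by (simp add: \<delta>_def)
  define V where "V x = (\<Inter>g\<in>G. g -` ball (g x) (\<delta>/2))" for x
  have cov: "UNIV \<subseteq> \<Union> (range V)" using \<delta> by (auto simp: V_def)
  have op: "open B" if "B \<in> range V" for B
    using that G by (auto simp: V_def intro!: open_INT open_vimage)
  obtain \<N> where N: "\<N> \<subseteq> range V" "finite \<N>" "UNIV \<subseteq> \<Union>\<N>"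
    by (rule compactE[OF cpt cov op])
  have "N \<in> sets borel \<and> (\<forall>g\<in>G. \<forall>x\<in>N. \<forall>y\<in>N. \<bar>g x - g y\<bar> \<le> \<delta>)" if "N \<in> \<N>" for N
  proof -
    obtain z where z: "N = V z" using \<open>N \<in> \<N>\<close> N(1) by blast
    have "open N" using G by (auto simp: V_def z intro!: open_INT open_vimage)
    moreover have "\<bar>g x - g y\<bar> \<le> \<delta>" if "g \<in> G" "x \<in> N" "y \<in> N" for g x y
    proof -
      have "dist (g z) (g x) < \<delta>/2" "dist (g z) (g y) < \<delta>/2" using that by (auto simp: z V_def)
      then show ?thesis unfolding dist_real_def by linarith
    qed
    ultimately show ?thesis by auto
  qed
  from discrete_approximation_on[OF \<mu> G(2) N(2) this, of UNIV] N(3)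
  obtain \<nu> where nu: "\<nu> \<in> discrete_measures" "\<forall>g\<in>G.
      \<bar>(LINT x|as_measure \<nu>. g x) - (LINT x|as_measure \<mu>. g x)\<bar> \<le> \<delta> * measure (as_measure \<mu>) UNIV"
    by auto
  have "\<delta> * measure (as_measure \<mu>) UNIV < \<delta> * (measure (as_measure \<mu>) UNIV + 1)" using \<delta> by simp
  also have "\<dots> = \<epsilon>" using m by (simp add: \<delta>_def)
  finally show ?thesis using nu by (meson le_less_trans)
qed

lemma compact_bounded_range:
  fixes f :: "'a::topological_space \<Rightarrow> 'b::metric_space"
  assumes "compact (UNIV :: 'a set)" "continuous_on UNIV f"
  shows "bounded (range f)"
  using assms compact_continuous_image compact_imp_bounded by blast

section \<open>Convolution with point masses\<close>

locale compact_commutative_hypergroup = hypergroup conv e tilde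
  for conv :: "'a::t2_space cmeasure \<Rightarrow> 'a cmeasure \<Rightarrow> 'a cmeasure" and e and tilde +
  assumes comm: "commutative_conv conv"
    and cpt: "compact (UNIV :: 'a set)"
begin

abbreviation pconv :: "'a \<Rightarrow> 'a \<Rightarrow> 'a cmeasure" where
  "pconv x y \<equiv> conv (point_mass x) (point_mass y)"

text \<open>The axioms state positivity only for products of point masses. For the whole cone it is
  read off from \<open>conv_weakly_continuous\<close>, since a \<open>continuous_map\<close> sends
  topspace into topspace.\<close>

lemma conv_positive:
  assumes "\<mu> \<in> positive_measures" "\<nu> \<in> positive_measures"
  shows "conv \<mu> \<nu> \<in> positive_measures"
  using continuous_map_image_subset_topspace[OF conv_weakly_continuous] assms
  by (auto simp: topspace_weak_topology topspace_prod_topology image_subset_iff)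

lemma continuous_integral_conv:
  fixes f :: "'a \<Rightarrow> real"
  assumes f: "continuous_on UNIV f"
    and "continuous_map X weak_topology \<mu>" "continuous_map X weak_topology \<nu>"
  shows "continuous_map X euclideanreal (\<lambda>x. LINT z|as_measure (conv (\<mu> x) (\<nu> x)). f z)"
proof -
  have "continuous_map X (prod_topology weak_topology weak_topology) (\<lambda>x. (\<mu> x, \<nu> x))"
    using assms by (simp add: continuous_map_pairedI)
  from continuous_map_compose[OF continuous_map_compose[OF this conv_weakly_continuous]
      continuous_map_weak_integral[OF f compact_bounded_range[OF cpt f]]]
  show ?thesis by (simp add: o_def)
qed

lemma continuous_integral_pconv:
  fixes f :: "'a \<Rightarrow> real"
  assumes "continuous_on UNIV f"
  shows "continuous_on UNIV (\<lambda>(w, u). LINT z|as_measure (pconv w u). f z)"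
proof -
  have "continuous_map euclidean weak_topology (\<lambda>p::'a\<times>'a. point_mass (fst p))"
       "continuous_map euclidean weak_topology (\<lambda>p::'a\<times>'a. point_mass (snd p))"
    by (rule continuous_map_compose[OF _ continuous_map_point_mass, unfolded o_def];
        simp add: continuous_on_fst continuous_on_snd)+
  from continuous_integral_conv[OF assms this] show ?thesis by (simp add: case_prod_unfold)
qed

lemma continuous_integral_pconv_left:
  fixes f :: "'a \<Rightarrow> real"
  assumes "continuous_on UNIV f"
  shows "continuous_on UNIV (\<lambda>w. LINT z|as_measure (pconv w u). f z)"
  using continuous_on_compose2[OF continuous_integral_pconv[OF assms], of UNIV "\<lambda>w. (w, u)"]
  by (simp add: continuous_on_Pair)

lemma conv_zero_left: "\<rho> \<in> bounded_measures \<Longrightarrow> conv (\<lambda>A. 0) \<rho> = (\<lambda>A. 0)"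
  using conv_linear_left[of \<rho> \<rho> \<rho> 0 0] by simp

text \<open>Linearity of the convolution in its first argument reduces the formula to a single atom,
  where the outer integral is an evaluation.\<close>

lemma integral_conv_discrete:
  fixes f :: "'a \<Rightarrow> real"
  assumes f: "continuous_on UNIV f" and "\<nu> \<in> discrete_measures"
  shows "(LINT z|as_measure (conv \<nu> (point_mass u)). f z) =
    (LINT w|as_measure \<nu>. LINT z|as_measure (pconv w u). f z)"
  using assms(2)
proof (induction rule: discrete_measures.induct)
  case zero
  then show ?case
    by (simp add: conv_zero_left positive_measuresD(1)[OF point_mass_positive] integral_as_measure_zero)
next
  case (add \<nu> c x)
  let ?g = "\<lambda>w. LINT z|as_measure (pconv w u). f z"
  have pos: "\<nu> \<in> positive_measures" using add(1) by (rule discrete_measures_positive)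
  have g: "continuous_on UNIV ?g" by (rule continuous_integral_pconv_left[OF f])
  have "conv (\<lambda>A. of_real 1 * \<nu> A + of_real c * point_mass x A) (point_mass u) =
      (\<lambda>A. of_real 1 * conv \<nu> (point_mass u) A + of_real c * pconv x u A)"
    by (rule conv_linear_left) (auto intro: positive_measuresD(1) pos point_mass_positive)
  then have "(LINT z|as_measure (conv (\<lambda>A. of_real 1 * \<nu> A + of_real c * point_mass x A) (point_mass u)). f z)
      = 1 * (LINT z|as_measure (conv \<nu> (point_mass u)). f z) + c * ?g x"
    by (simp only:) (intro integral_as_measure_lincomb conv_positive pos point_mass_positive zero_le_one
        add(2) f compact_bounded_range[OF cpt])
  also have "\<dots> = 1 * (LINT w|as_measure \<nu>. ?g w) + c * (LINT w|as_measure (point_mass x). ?g w)"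
    by (simp add: add.IH integral_point_mass[OF g])
  also have "\<dots> = (LINT w|as_measure (\<lambda>A. of_real 1 * \<nu> A + of_real c * point_mass x A). ?g w)"
    by (intro integral_as_measure_lincomb[symmetric] pos point_mass_positive zero_le_one
        add(2) g compact_bounded_range[OF cpt])
  finally show ?case .
qed

text \<open>Both sides are weakly continuous in \<open>\<mu>\<close> and agree on combinations of point masses,
  which are weakly dense.\<close>

lemma integral_conv_point_mass:
  fixes f :: "'a \<Rightarrow> real"
  assumes f: "continuous_on UNIV f" and \<mu>: "\<mu> \<in> positive_measures"
  shows "(LINT z|as_measure (conv \<mu> (point_mass u)). f z) =
    (LINT w|as_measure \<mu>. LINT z|as_measure (pconv w u). f z)"
proof -
  let ?g = "\<lambda>w. LINT z|as_measure (pconv w u). f z"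
  let ?F = "\<lambda>\<mu>. LINT z|as_measure (conv \<mu> (point_mass u)). f z"
  have g: "continuous_on UNIV ?g" by (rule continuous_integral_pconv_left[OF f])
  have F: "continuous_map weak_topology euclideanreal ?F"
    by (rule continuous_integral_conv[OF f])
      (auto simp: topspace_weak_topology point_mass_positive)
  have "\<bar>?F \<mu> - (LINT w|as_measure \<mu>. ?g w)\<bar> \<le> \<epsilon>" if "\<epsilon> > 0" for \<epsilon>
  proof -
    \<comment> \<open>\<open>?F\<close> is weakly continuous, so staying within
      \<open>\<epsilon>/2\<close> of its value at \<open>\<mu>\<close> is guaranteed by finitely
      many test functions.\<close>
    define W where "W = {\<nu> \<in> positive_measures. ?F \<nu> \<in> ball (?F \<mu>) (\<epsilon>/2)}"
    have "openin weak_topology W"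
      using openin_continuous_map_preimage[OF F, of "ball (?F \<mu>) (\<epsilon>/2)"]
      by (simp add: W_def topspace_weak_topology)
    moreover have "\<mu> \<in> W" using \<mu> that by (simp add: W_def)
    ultimately have "\<exists>(G :: ('a \<Rightarrow> real) set) \<delta>. finite G \<and> \<delta> > 0 \<and>
        (\<forall>g\<in>G. continuous_on UNIV g \<and> bounded (range g)) \<and>
        (\<forall>\<nu>\<in>positive_measures.
          (\<forall>g\<in>G. \<bar>(LINT x|as_measure \<nu>. g x) - (LINT x|as_measure \<mu>. g x)\<bar> < \<delta>) \<longrightarrow> \<nu> \<in> W)"
      by (rule weak_neighbourhood)
    then obtain G :: "('a \<Rightarrow> real) set" and \<delta> where G: "finite G" "\<delta> > 0" "\<forall>g\<in>G. continuous_on UNIV g \<and> bounded (range g)"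
      "\<forall>\<nu>\<in>positive_measures. (\<forall>g\<in>G. \<bar>(LINT x|as_measure \<nu>. g x) - (LINT x|as_measure \<mu>. g x)\<bar> < \<delta>) \<longrightarrow> \<nu> \<in> W"
      by (elim exE conjE) (rule that, assumption+)
    \<comment> \<open>Joining \<open>?g\<close> to the test functions lets one discrete measure
      control both sides of the identity.\<close>
    have "\<exists>\<nu>\<in>discrete_measures. \<forall>g\<in>insert ?g G.
        \<bar>(LINT x|as_measure \<nu>. g x) - (LINT x|as_measure \<mu>. g x)\<bar> < min \<delta> (\<epsilon>/2)"
      by (rule discrete_approximation[OF cpt \<mu>])
        (use G that g compact_bounded_range[OF cpt g] in auto)
    then obtain \<nu> where \<nu>: "\<nu> \<in> discrete_measures"
      "\<And>g. g \<in> insert ?g G \<Longrightarrow> \<bar>(LINT x|as_measure \<nu>. g x) - (LINT x|as_measure \<mu>. g x)\<bar> < min \<delta> (\<epsilon>/2)"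
      by blast
    have "\<nu> \<in> W" using G(4) \<nu> discrete_measures_positive by auto
    then have "\<bar>?F \<nu> - ?F \<mu>\<bar> < \<epsilon>/2" by (simp add: W_def dist_real_def abs_minus_commute)
    moreover have "\<bar>(LINT x|as_measure \<nu>. ?g x) - (LINT x|as_measure \<mu>. ?g x)\<bar> < \<epsilon>/2"
      using \<nu>(2)[of ?g] by simp
    ultimately show ?thesis using integral_conv_discrete[OF f \<nu>(1), of u] by linarith
  qed
  then have "\<bar>?F \<mu> - (LINT w|as_measure \<mu>. ?g w)\<bar> \<le> 0" by (rule field_le_epsilon) simp
  then show ?thesis by simp
qed

end

section \<open>Interchanging integrals of continuous functions\<close>

lemma integrable_continuous_compact:
  fixes f :: "'a::topological_space \<Rightarrow> 'b::{second_countable_topology, banach}"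
  assumes "compact (UNIV :: 'a set)" "finite_measure M" "sets M = sets borel" "continuous_on UNIV f"
  shows "integrable M f"
proof -
  interpret finite_measure M by fact
  obtain B where "\<And>x. norm (f x) \<le> B"
    using compact_bounded_range[OF assms(1,4)] by (auto simp: bounded_iff)
  then show ?thesis
    by (intro integrable_const_bound[of _ B] AE_I2)
      (auto simp: measurable_cong_sets[OF assms(3) refl] intro: borel_measurable_continuous_onI assms(4))
qed

lemma norm_integral_diff_le:
  fixes f g :: "'a::topological_space \<Rightarrow> 'b::{second_countable_topology, banach}"
  assumes "compact (UNIV :: 'a set)" "finite_measure M" "sets M = sets borel"
    "continuous_on UNIV f" "continuous_on UNIV g" "\<And>x. norm (f x - g x) \<le> \<epsilon>"
  shows "norm ((LINT x|M. f x) - (LINT x|M. g x)) \<le> \<epsilon> * measure M UNIV"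
proof -
  interpret finite_measure M by fact
  have sp: "space M = UNIV" using sets_eq_imp_space_eq[OF assms(3)] by simp
  note int = integrable_continuous_compact[OF assms(1-3)]
  have "norm ((LINT x|M. f x) - (LINT x|M. g x)) = norm (LINT x|M. f x - g x)"
    by (simp add: Bochner_Integration.integral_diff int assms(4,5))
  also have "\<dots> \<le> (LINT x|M. norm (f x - g x))" by (rule integral_norm_bound)
  also have "\<dots> \<le> (LINT x|M. \<epsilon>)"
    by (rule integral_mono) (auto intro!: int continuous_on_norm continuous_on_diff assms(4-6))
  also have "\<dots> = \<epsilon> * measure M UNIV" by (simp add: sp)
  finally show ?thesis .
qed

text \<open>
  Borel sets of the product need not be generated by rectangles, so Tonelli's theorem does not apply;
  continuous functions are instead approximated uniformly by sums of products.
\<close>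

inductive tensor_sum :: "('a::topological_space \<times> 'b::topological_space \<Rightarrow> real) \<Rightarrow> bool" where
  prod: "continuous_on UNIV g \<Longrightarrow> continuous_on UNIV h \<Longrightarrow> tensor_sum (\<lambda>p. g (fst p) * h (snd p))"
| add: "tensor_sum F \<Longrightarrow> tensor_sum G \<Longrightarrow> tensor_sum (\<lambda>p. F p + G p)"

lemma tensor_sum_continuous: "tensor_sum F \<Longrightarrow> continuous_on UNIV F"
proof (induction rule: tensor_sum.induct)
  case (prod g h)
  then show ?case
    using continuous_on_compose2[of UNIV g UNIV fst] continuous_on_compose2[of UNIV h UNIV snd]
    by (intro continuous_on_mult) (simp_all add: continuous_on_fst continuous_on_snd)
qed (auto intro: continuous_on_add)

text \<open>Closure under products makes the tensor sums an algebra, as Stone-Weierstrass requires;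
  distributivity reduces it to two elementary products.\<close>

lemma tensor_sum_mult: "tensor_sum F \<Longrightarrow> tensor_sum G \<Longrightarrow> tensor_sum (\<lambda>p. F p * G p)"
proof (induction rule: tensor_sum.induct)
  case (prod g h)
  note gh = prod(1,2)
  from prod(3) show ?case
  proof (induction rule: tensor_sum.induct)
    case (prod g' h')
    have "tensor_sum (\<lambda>p. (g (fst p) * g' (fst p)) * (h (snd p) * h' (snd p)))"
      by (rule tensor_sum.prod[of "\<lambda>x. g x * g' x" "\<lambda>x. h x * h' x"]) (intro continuous_on_mult gh prod)+
    then show ?case by (simp add: mult_ac)
  next
    case (add F G)
    then show ?case by (simp add: distrib_left tensor_sum.add)
  qed
next
  case (add F F')
  then show ?case by (simp add: distrib_right tensor_sum.add)
qed

text \<open>Stone-Weierstrass on the compact product: distinct points differ in some coordinate, and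
  a function of that coordinate alone separates them.\<close>

lemma tensor_sum_dense:
  fixes F :: "'a::t2_space \<times> 'b::t2_space \<Rightarrow> real"
  assumes "compact (UNIV :: 'a set)" "compact (UNIV :: 'b set)"
    and sepa: "\<And>x y :: 'a. x \<noteq> y \<Longrightarrow> \<exists>f :: 'a \<Rightarrow> real. continuous_on UNIV f \<and> f x \<noteq> f y"
    and sepb: "\<And>x y :: 'b. x \<noteq> y \<Longrightarrow> \<exists>f :: 'b \<Rightarrow> real. continuous_on UNIV f \<and> f x \<noteq> f y"
    and "continuous_on UNIV F" "\<epsilon> > 0"
  shows "\<exists>G. tensor_sum G \<and> (\<forall>p. \<bar>F p - G p\<bar> < \<epsilon>)"
proof -
  have fst: "tensor_sum (\<lambda>p. f (fst p))" if "continuous_on UNIV f" for f :: "'a \<Rightarrow> real"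
    using tensor_sum.prod[OF that, of "\<lambda>_. 1"] by simp
  have snd: "tensor_sum (\<lambda>p. f (snd p))" if "continuous_on UNIV f" for f :: "'b \<Rightarrow> real"
    using tensor_sum.prod[of "\<lambda>_. 1", OF _ that] by simp
  have "function_ring_on (Collect (tensor_sum :: ('a \<times> 'b \<Rightarrow> real) \<Rightarrow> bool)) UNIV"
  proof
    show "compact (UNIV :: ('a \<times> 'b) set)" using compact_Times[OF assms(1,2)] by simp
    show "(\<lambda>_. c) \<in> Collect (tensor_sum :: ('a \<times> 'b \<Rightarrow> real) \<Rightarrow> bool)" for c :: real
      using fst[of "\<lambda>_. c"] by simp
    fix x y :: "'a \<times> 'b" assume "x \<noteq> y"
    then consider "fst x \<noteq> fst y" | "snd x \<noteq> snd y" by (auto simp: prod_eq_iff)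
    then show "\<exists>f\<in>Collect tensor_sum. f x \<noteq> f y"
    proof cases
      case 1
      then obtain f :: "'a \<Rightarrow> real" where "continuous_on UNIV f" "f (fst x) \<noteq> f (fst y)"
        using sepa[OF 1] by (elim exE conjE)
      then show ?thesis by (intro bexI[of _ "\<lambda>p. f (fst p)"]) (simp_all add: fst)
    next
      case 2
      then obtain f :: "'b \<Rightarrow> real" where "continuous_on UNIV f" "f (snd x) \<noteq> f (snd y)"
        using sepb[OF 2] by (elim exE conjE)
      then show ?thesis by (intro bexI[of _ "\<lambda>p. f (snd p)"]) (simp_all add: snd)
    qed
  qed (auto simp: tensor_sum_continuous tensor_sum_mult tensor_sum.add)
  from function_ring_on.Stone_Weierstrass_basic[OF this assms(5,6)] show ?thesis by auto
qed

text \<open>A compact Hausdorff space is normal, so Urysohn's lemma applies. It will separate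
  points, isolate supports from \<open>e\<close> and produce bumps at \<open>e\<close>.\<close>

lemma compact_urysohn:
  fixes S T :: "'a::t2_space set"
  assumes "compact (UNIV :: 'a set)" "closed S" "closed T" "S \<inter> T = {}"
  obtains f :: "'a \<Rightarrow> real" where "continuous_on UNIV f" "\<And>x. 0 \<le> f x"
    "\<And>x. x \<in> S \<Longrightarrow> f x = 0" "\<And>x. x \<in> T \<Longrightarrow> f x = 1"
proof -
  have "Hausdorff_space (euclidean :: 'a topology)"
    unfolding Hausdorff_space_def
  proof (intro allI impI)
    fix x y :: 'a assume "x \<in> topspace euclidean \<and> y \<in> topspace euclidean \<and> x \<noteq> y"
    then obtain U V where "open U" "open V" "x \<in> U" "y \<in> V" "U \<inter> V = {}"
      using hausdorff[of x y] by blast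
    then show "\<exists>U V. openin euclidean U \<and> openin euclidean V \<and> x \<in> U \<and> y \<in> V \<and> disjnt U V"
      by (intro exI[of _ U] exI[of _ V]) (simp add: disjnt_def)
  qed
  then have "normal_space (euclidean :: 'a topology)"
    using assms(1) by (intro compact_Hausdorff_or_regular_imp_normal_space) (auto simp: compact_space_def)
  then obtain f where "continuous_map (euclidean :: 'a topology) (top_of_set {0..1::real}) f" 
    "f ` S \<subseteq> {0}" "f ` T \<subseteq> {1}"
    by (rule Urysohn_lemma[of _ S T 0 1]) (use assms in \<open>auto simp: disjnt_def\<close>)
  then show thesis
    by (intro that[of f]) (auto simp: continuous_map_in_subtopology)
qed

lemma compact_separating_function:
  fixes x y :: "'a::t2_space"
  assumes "compact (UNIV :: 'a set)" "x \<noteq> y"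
  shows "\<exists>f :: 'a \<Rightarrow> real. continuous_on UNIV f \<and> f x \<noteq> f y"
proof -
  obtain f :: "'a \<Rightarrow> real" where "continuous_on UNIV f" "\<And>z. z \<in> {x} \<Longrightarrow> f z = 0" "\<And>z. z \<in> {y} \<Longrightarrow> f z = 1"
    by (rule compact_urysohn[OF assms(1), of "{x}" "{y}"]) (use assms(2) in auto)
  then show ?thesis by (intro exI[of _ f]) auto
qed

lemma continuous_on_section_left:
  "continuous_on UNIV F \<Longrightarrow> continuous_on UNIV (\<lambda>x. F (x, y))"
  by (rule continuous_on_compose2) (auto intro!: continuous_on_Pair)

lemma continuous_on_section_right:
  "continuous_on UNIV F \<Longrightarrow> continuous_on UNIV (\<lambda>y. F (x, y))"
  by (rule continuous_on_compose2) (auto intro!: continuous_on_Pair)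

section \<open>Fubini's theorem for continuous functions on compact spaces\<close>

locale compact_fubini =
  fixes M :: "'a::t2_space measure" and N :: "'b::t2_space measure"
  assumes cptM: "compact (UNIV :: 'a set)" and cptN: "compact (UNIV :: 'b set)"
    and finM: "finite_measure M" and finN: "finite_measure N"
    and setsM: "sets M = sets borel" and setsN: "sets N = sets borel"
begin

lemma tensor_sum_approximation:
  "continuous_on UNIV F \<Longrightarrow> \<epsilon> > 0 \<Longrightarrow>
    \<exists>G. tensor_sum G \<and> (\<forall>p :: 'a \<times> 'b. \<bar>F p - G p\<bar> < \<epsilon>)"
  by (rule tensor_sum_dense[OF cptM cptN compact_separating_function[OF cptM] compact_separating_function[OF cptN]])

lemma continuous_integral_tensor_sum:
  assumes "tensor_sum F"
  shows "continuous_on UNIV (\<lambda>y. LINT x|M. F (x, y))"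
  using assms
proof (induction rule: tensor_sum.induct)
  case (prod g h)
  then show ?case by (auto intro!: continuous_intros)
next
  case (add F G)
  have "integrable M (\<lambda>x. F (x, y))" "integrable M (\<lambda>x. G (x, y))" for y
    by (intro integrable_continuous_compact[OF cptM finM setsM] continuous_on_section_left tensor_sum_continuous add)+
  then show ?case using add.IH by (simp add: continuous_on_add)
qed

text \<open>Uniform approximation of \<open>F\<close> by tensor sums makes the partial integrals
  converge uniformly in \<open>y\<close>, because \<open>M\<close> is finite; a uniform limit of
  continuous functions is continuous.\<close>

lemma continuous_integral_section_real:
  fixes F :: "'a \<times> 'b \<Rightarrow> real"
  assumes F: "continuous_on UNIV F"
  shows "continuous_on UNIV (\<lambda>y. LINT x|M. F (x, y))"
proof -
  \<comment> \<open>A number strictly above the total mass, so that dividing the tolerance by it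
    gives a strict bound for the integrals.\<close>
  define m where "m = measure M UNIV + 1"
  have m: "m > 0" "measure M UNIV < m" by (auto simp: m_def add_nonneg_pos)
  have "\<exists>G. tensor_sum G \<and> (\<forall>p. \<bar>F p - G p\<bar> < inverse (Suc n) / m)" for n
    by (rule tensor_sum_approximation[OF F]) (use m in simp)
  then obtain G where G: "\<And>n. tensor_sum (G n)" "\<And>n p. \<bar>F p - G n p\<bar> < inverse (Suc n) / m" by metis
  have "uniform_limit UNIV (\<lambda>n y. LINT x|M. G n (x, y)) (\<lambda>y. LINT x|M. F (x, y)) sequentially"
  proof (rule uniform_limitI)
    fix \<epsilon> :: real assume "\<epsilon> > 0"
    have "dist (LINT x|M. G n (x, y)) (LINT x|M. F (x, y)) < inverse (Suc n)" for n y
    proof -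
      have "norm ((LINT x|M. F (x, y)) - (LINT x|M. G n (x, y))) \<le> inverse (Suc n) / m * measure M UNIV"
      proof (rule norm_integral_diff_le[OF cptM finM setsM])
        show "norm (F (x, y) - G n (x, y)) \<le> inverse (Suc n) / m" for x
          unfolding real_norm_def by (rule less_imp_le[OF G(2)])
      qed (intro continuous_on_section_left F tensor_sum_continuous G(1))+
      also have "\<dots> < inverse (Suc n) / m * m" using m by (intro mult_strict_left_mono) auto
      finally show ?thesis using m by (simp add: dist_norm norm_minus_commute)
    qed
    moreover have "\<forall>\<^sub>F n in sequentially. inverse (Suc n) < \<epsilon>"
      by (rule order_tendstoD(2)[OF LIMSEQ_inverse_real_of_nat \<open>\<epsilon> > 0\<close>])
    ultimately show "\<forall>\<^sub>F n in sequentially. \<forall>y\<in>UNIV. dist (LINT x|M. G n (x, y)) (LINT x|M. F (x, y)) < \<epsilon>"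
      by (elim eventually_mono) (blast intro: less_trans)
  qed
  then show ?thesis
    by (rule uniform_limit_theorem[rotated])
      (simp_all add: always_eventually continuous_integral_tensor_sum G(1))
qed

text \<open>The assumptions are symmetric, so each result on integrating out the first variable
  yields its mirror image.\<close>

lemma swapped: "compact_fubini N M"
  using compact_fubini_axioms by (simp add: compact_fubini_def)

lemma continuous_integral_section_real':
  fixes F :: "'a \<times> 'b \<Rightarrow> real"
  assumes F: "continuous_on UNIV F"
  shows "continuous_on UNIV (\<lambda>x. LINT y|N. F (x, y))"
  using compact_fubini.continuous_integral_section_real[OF swapped, of "F \<circ> prod.swap"]
    continuous_on_compose[of UNIV prod.swap F] F
  by (simp add: o_def continuous_on_swap continuous_on_subset)

lemma integral_swap_tensor_sum:
  assumes "tensor_sum F"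
  shows "(LINT y|N. LINT x|M. F (x, y)) = (LINT x|M. LINT y|N. F (x, y))"
  using assms
proof (induction rule: tensor_sum.induct)
  case (prod g h)
  then show ?case by simp
next
  case (add F G)
  note c = tensor_sum_continuous[OF add(1)] tensor_sum_continuous[OF add(2)]
  note iM = integrable_continuous_compact[OF cptM finM setsM]
  note iN = integrable_continuous_compact[OF cptN finN setsN]
  have "(LINT y|N. LINT x|M. F (x, y) + G (x, y)) =
      (LINT y|N. LINT x|M. F (x, y)) + (LINT y|N. LINT x|M. G (x, y))"
    by (simp add: iM iN continuous_on_section_left c continuous_integral_section_real)
  moreover have "(LINT x|M. LINT y|N. F (x, y) + G (x, y)) =
      (LINT x|M. LINT y|N. F (x, y)) + (LINT x|M. LINT y|N. G (x, y))"
    by (simp add: iM iN continuous_on_section_right c continuous_integral_section_real')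
  ultimately show ?case using add.IH by simp
qed

lemma integral_swap_real:
  fixes F :: "'a \<times> 'b \<Rightarrow> real"
  assumes F: "continuous_on UNIV F"
  shows "(LINT y|N. LINT x|M. F (x, y)) = (LINT x|M. LINT y|N. F (x, y))"
proof -
  let ?I = "\<lambda>F. LINT y|N. LINT x|M. F (x, y)" and ?J = "\<lambda>F. LINT x|M. LINT y|N. F (x, y)"
  define m where "m = measure M UNIV * measure N UNIV"
  have m: "m \<ge> 0" by (simp add: m_def)
  have "\<bar>?I F - ?J F\<bar> \<le> \<epsilon>" if "\<epsilon> > 0" for \<epsilon>
  proof -
    \<comment> \<open>Replacing \<open>F\<close> by \<open>G\<close> moves each of the two iterated
      integrals by at most \<open>d * m\<close>, hence the factor 2; the summand 1 covers
      \<open>m = 0\<close>.\<close>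
    define d where "d = \<epsilon> / (2 * (m + 1))"
    have d: "d > 0" using m that by (simp add: d_def)
    obtain G where G: "tensor_sum G" "\<And>p. \<bar>F p - G p\<bar> < d" using tensor_sum_approximation[OF F d] by blast
    note Gc = tensor_sum_continuous[OF G(1)]
    have "norm ((LINT x|M. F (x, y)) - (LINT x|M. G (x, y))) \<le> d * measure M UNIV" for y
      by (rule norm_integral_diff_le[OF cptM finM setsM])
        (auto intro!: continuous_on_section_left F Gc less_imp_le[OF G(2)])
    then have "norm (?I F - ?I G) \<le> d * measure M UNIV * measure N UNIV"
      by (intro norm_integral_diff_le[OF cptN finN setsN] continuous_integral_section_real F Gc)
    moreover have "norm ((LINT y|N. F (x, y)) - (LINT y|N. G (x, y))) \<le> d * measure N UNIV" for x
      by (rule norm_integral_diff_le[OF cptN finN setsN])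
        (auto intro!: continuous_on_section_right F Gc less_imp_le[OF G(2)])
    then have "norm (?J F - ?J G) \<le> d * measure N UNIV * measure M UNIV"
      by (intro norm_integral_diff_le[OF cptM finM setsM] continuous_integral_section_real' F Gc)
    moreover have "2 * (d * m) \<le> \<epsilon>"
    proof -
      have "2 * (d * m) \<le> 2 * (d * (m + 1))" using d by simp
      also have "\<dots> = \<epsilon>" using m by (simp add: d_def field_simps)
      finally show ?thesis .
    qed
    ultimately show ?thesis using integral_swap_tensor_sum[OF G(1)]
      by (simp add: m_def mult_ac)
  qed
  then have "\<bar>?I F - ?J F\<bar> \<le> 0" by (rule field_le_epsilon) simp
  then show ?thesis by simp
qed

text \<open>Tensor sums are real valued, so the complex case is assembled from real and imaginary
  parts.\<close>

lemma continuous_integral_section: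
  fixes F :: "'a \<times> 'b \<Rightarrow> complex"
  assumes F: "continuous_on UNIV F"
  shows "continuous_on UNIV (\<lambda>y. LINT x|M. F (x, y))"
proof -
  have "integrable M (\<lambda>x. F (x, y))" for y
    by (intro integrable_continuous_compact[OF cptM finM setsM] continuous_on_section_left F)
  then have "(\<lambda>y. LINT x|M. F (x, y)) = (\<lambda>y. Complex (LINT x|M. Re (F (x, y))) (LINT x|M. Im (F (x, y))))"
    by (auto simp: complex_eq_iff)
  moreover have "continuous_on UNIV (\<lambda>p. Re (F p))" "continuous_on UNIV (\<lambda>p. Im (F p))"
    by (intro continuous_intros F)+
  moreover note this[THEN continuous_integral_section_real]
  ultimately show ?thesis
    by (simp only: Complex_eq) (intro continuous_on_add continuous_on_mult continuous_on_const continuous_on_of_real)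
qed

lemma continuous_integral_section':
  fixes F :: "'a \<times> 'b \<Rightarrow> complex"
  assumes F: "continuous_on UNIV F"
  shows "continuous_on UNIV (\<lambda>x. LINT y|N. F (x, y))"
  using compact_fubini.continuous_integral_section[OF swapped, of "F \<circ> prod.swap"]
    continuous_on_compose[of UNIV prod.swap F] F
  by (simp add: o_def continuous_on_swap continuous_on_subset)

lemma integral_swap:
  fixes F :: "'a \<times> 'b \<Rightarrow> complex"
  assumes F: "continuous_on UNIV F"
  shows "(LINT y|N. LINT x|M. F (x, y)) = (LINT x|M. LINT y|N. F (x, y))"
proof -
  note iM = integrable_continuous_compact[OF cptM finM setsM]
  note iN = integrable_continuous_compact[OF cptN finN setsN]
  have 1: "integrable M (\<lambda>x. F (x, y))" for y by (rule iM[OF continuous_on_section_left[OF F]])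
  have 2: "integrable N (\<lambda>y. F (x, y))" for x by (rule iN[OF continuous_on_section_right[OF F]])
  have 3: "integrable N (\<lambda>y. LINT x|M. F (x, y))" by (rule iN[OF continuous_integral_section[OF F]])
  have 4: "integrable M (\<lambda>x. LINT y|N. F (x, y))" by (rule iM[OF continuous_integral_section'[OF F]])
  have "continuous_on UNIV (\<lambda>p. Re (F p))" "continuous_on UNIV (\<lambda>p. Im (F p))"
    by (intro continuous_intros F)+
  from this[THEN integral_swap_real] 1 2 3 4 show ?thesis by (simp add: complex_eq_iff)
qed

end

section \<open>Supports that stay away from the identity\<close>

context compact_commutative_hypergroup begin

text \<open>At a pair in \<open>C\<close> the support misses \<open>e\<close> by
  \<open>identity_in_supp\<close>, so it lies in an open set disjoint from a neighbourhood of
  \<open>e\<close>. Continuity into the Michael topology keeps nearby supports in that open set, and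
  compactness of \<open>C\<close> makes one neighbourhood of \<open>e\<close> serve all
  pairs.\<close>

lemma supp_avoids_identity:
  assumes C: "closed C" "\<And>w u. (w, u) \<in> C \<Longrightarrow> u \<noteq> tilde w"
  obtains U where "open U" "e \<in> U" "\<forall>w u. (w, u) \<in> C \<longrightarrow> supp (pconv w u) \<inter> U = {}"
proof -
  define \<T> where "\<T> = {N. open N \<and> (\<exists>U. open U \<and> e \<in> U \<and> (\<forall>w u. (w, u) \<in> N \<longrightarrow> supp (pconv w u) \<inter> U = {}))}"
  have cov: "C \<subseteq> \<Union>\<T>"
  proof safe
    fix w u assume wu: "(w, u) \<in> C"
    let ?S = "supp (pconv w u)"
    have "e \<notin> ?S" using C(2)[OF wu] by (simp add: identity_in_supp)
    moreover have "closed ?S" by (rule measure_compl_supp(2)[OF conv_point_positive])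
    ultimately obtain f :: "'a \<Rightarrow> real" where f: "continuous_on UNIV f" "\<And>x. 0 \<le> f x"
        "\<And>x. x \<in> ?S \<Longrightarrow> f x = 0" "\<And>x. x \<in> {e} \<Longrightarrow> f x = 1"
      by (rule_tac compact_urysohn[OF cpt _ closed_singleton, of ?S e]) simp_all
    \<comment> \<open>The function is 0 on the support and 1 at \<open>e\<close>; cutting it at 1/2
      separates the two by open sets.\<close>
    define U V where "U = f -` {1/2<..}" and "V = f -` {..<1/2}"
    have UV: "open U" "open V" "e \<in> U" "?S \<subseteq> V" "U \<inter> V = {}"
      using f by (auto simp: U_def V_def intro!: open_vimage)
    \<comment> \<open>With \<open>UNIV\<close> as the set to be met, this generating set consists of
      the nonempty compact sets inside \<open>V\<close>.\<close>
    let ?W = "{K. compact K \<and> K \<noteq> {} \<and> K \<inter> UNIV \<noteq> {} \<and> K \<subseteq> V}"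
    have "openin michael_topology ?W"
      unfolding michael_topology_def by (rule topology_generated_by_Basis) (use UV in blast)
    from openin_continuous_map_preimage[OF supp_continuous this]
    have op: "open {p. (case p of (x, y) \<Rightarrow> supp (pconv x y)) \<in> ?W}" by simp
    have "?S \<in> topspace michael_topology"
      using continuous_map_image_subset_topspace[OF supp_continuous] by fastforce
    then have "compact ?S" "?S \<noteq> {}" by (auto simp: michael_topology_def)
    then have "(w, u) \<in> {p. (case p of (x, y) \<Rightarrow> supp (pconv x y)) \<in> ?W}" using UV by auto
    moreover have "{p. (case p of (x, y) \<Rightarrow> supp (pconv x y)) \<in> ?W} \<in> \<T>"
      unfolding \<T>_def using op UV by (intro CollectI conjI exI[of _ U]) auto
    ultimately show "(w, u) \<in> \<Union>\<T>" by blast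
  qed
  have "compact C"
    using closed_Int_compact[OF C(1) compact_Times[OF cpt cpt]] by simp
  have op: "open N" if "N \<in> \<T>" for N using that by (simp add: \<T>_def)
  obtain \<F> where F: "\<F> \<subseteq> \<T>" "finite \<F>" "C \<subseteq> \<Union>\<F>"
    by (rule compactE[OF \<open>compact C\<close> cov op])
  have "\<forall>N\<in>\<F>. \<exists>U. open U \<and> e \<in> U \<and> (\<forall>w u. (w, u) \<in> N \<longrightarrow> supp (pconv w u) \<inter> U = {})"
    using F(1) by (auto simp: \<T>_def)
  from bchoice[OF this] obtain U where
    U: "\<forall>N\<in>\<F>. open (U N) \<and> e \<in> U N \<and> (\<forall>w u. (w, u) \<in> N \<longrightarrow> supp (pconv w u) \<inter> U N = {})" ..
  show thesis
  proof (rule that[of "\<Inter>N\<in>\<F>. U N"])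
    show "open (\<Inter>N\<in>\<F>. U N)" using F(2) U by (intro open_INT) auto
    show "e \<in> (\<Inter>N\<in>\<F>. U N)" using U by auto
    have "supp (pconv w u) \<inter> (\<Inter>N\<in>\<F>. U N) = {}" if wu: "(w, u) \<in> C" for w u
    proof -
      obtain N where "N \<in> \<F>" "(w, u) \<in> N" using F(3) wu by auto
      then show ?thesis using U by blast
    qed
    then show "\<forall>w u. (w, u) \<in> C \<longrightarrow> supp (pconv w u) \<inter> (\<Inter>N\<in>\<F>. U N) = {}" by simp
  qed
qed

end

section \<open>Haar measure and orthogonality of characters\<close>

text \<open>If the integral vanished, \<open>f\<close> would vanish almost everywhere, and the set
  where it is positive would be a null open neighbourhood of a point of the support.\<close>

lemma integral_as_measure_pos:
  fixes f :: "'a::t2_space \<Rightarrow> real"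
  assumes \<mu>: "\<mu> \<in> positive_measures" and f: "continuous_on UNIV f" "bounded (range f)" "\<And>z. 0 \<le> f z"
    and x: "x \<in> supp \<mu>" "f x > 0"
  shows "(LINT z|as_measure \<mu>. f z) > 0"
proof -
  define U where "U = f -` {0<..}"
  have U: "open U" "x \<in> U" using f x by (auto simp: U_def intro!: open_vimage)
  have int: "integrable (as_measure \<mu>) f" by (rule integrable_as_measure) fact+
  have "(LINT z|as_measure \<mu>. f z) \<noteq> 0"
  proof
    assume "(LINT z|as_measure \<mu>. f z) = 0"
    then have "AE z in as_measure \<mu>. f z = 0"
      using integral_nonneg_eq_0_iff_AE[OF int] f(3) by simp
    then have "AE z in as_measure \<mu>. z \<notin> U" by eventually_elim (simp add: U_def)
    moreover have "U \<in> sets (as_measure \<mu>)" using U(1) by simp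
    ultimately have "emeasure (as_measure \<mu>) U = 0" using AE_iff_measurable[of U "as_measure \<mu>" "\<lambda>z. z \<notin> U"] by simp
    then have "Re (\<mu> U) \<le> 0"
      using U(1) by (simp add: emeasure_as_measure[OF \<mu>] ennreal_eq_0_iff)
    then have "\<mu> U = 0" using positive_measuresD(2,3)[OF \<mu>, of U] by (simp add: complex_eq_iff)
    then show False using x(1) U by (auto simp: supp_def)
  qed
  moreover have "(LINT z|as_measure \<mu>. f z) \<ge> 0" by (rule integral_nonneg_AE) (simp add: f(3))
  ultimately show ?thesis by simp
qed

section \<open>Invariance and strict positivity of the Haar measure\<close>

locale normalized_haar = compact_commutative_hypergroup conv e tilde
  for conv :: "'a::t2_space cmeasure \<Rightarrow> 'a cmeasure \<Rightarrow> 'a cmeasure" and e and tilde +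
  fixes haar :: "'a measure"
  assumes haar: "haar_measure conv haar"
    and haar_one: "emeasure haar UNIV = 1"
begin

lemma sets_haar: "sets haar = sets borel"
  using haar by (simp add: haar_measure_def)

lemma space_haar: "space haar = UNIV"
  using sets_eq_imp_space_eq[OF sets_haar] by simp

lemma finite_haar: "finite_measure haar"
  by (rule finite_measureI) (simp add: space_haar haar_one)

lemma measure_haar: "measure haar UNIV = 1"
  by (simp add: measure_def haar_one)

lemma finite_pconv: "finite_measure (as_measure (pconv x y))"
  by (rule finite_measure_as_measure[OF conv_point_positive])

lemma measure_pconv: "measure (as_measure (pconv x y)) UNIV = 1"
  by (simp add: measure_as_measure[OF conv_point_positive] conv_point_prob)

text \<open>On a compact space every continuous function has compact support; the real case is
  embedded in the complex one.\<close>

lemma haar_invariant: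
  fixes f :: "'a \<Rightarrow> real"
  assumes "continuous_on UNIV f"
  shows "(LINT y|haar. LINT z|as_measure (pconv x y). f z) = (LINT y|haar. f y)"
proof -
  have "compact (closure {y. complex_of_real (f y) \<noteq> 0})"
    using closed_Int_compact[OF closed_closure cpt] by simp
  moreover have "continuous_on UNIV (\<lambda>y. complex_of_real (f y))"
    by (intro continuous_on_of_real assms)
  ultimately have "(LINT y|haar. LINT z|as_measure (pconv x y). complex_of_real (f z)) = (LINT y|haar. complex_of_real (f y))"
    using haar unfolding haar_measure_def by blast
  then show ?thesis by simp
qed

text \<open>By invariance each translate \<open>L x\<close> of \<open>k\<close> has the same
  integral as \<open>k\<close>. Every point lies where some translate is positive, so by compactness
  a finite sum of translates has a positive minimum, while its integral is a multiple of that of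
  \<open>k\<close>.\<close>

lemma haar_pos:
  fixes k :: "'a \<Rightarrow> real"
  assumes k: "continuous_on UNIV k" "\<And>x. 0 \<le> k x" "k e > 0"
  shows "(LINT x|haar. k x) > 0"
proof -
  define L where "L = (\<lambda>x u. LINT z|as_measure (pconv x u). k z)"
  have Lc: "continuous_on UNIV (L x)" for x
    unfolding L_def using continuous_on_section_right[OF continuous_integral_pconv[OF k(1)]] by simp
  have L0: "L x u \<ge> 0" for x u
    unfolding L_def by (rule integral_nonneg_AE) (simp add: k(2))
  \<comment> \<open>\<open>e\<close> lies in the support of \<open>pconv (tilde u) u\<close> because
    \<open>u = tilde (tilde u)\<close>.\<close>
  have Lpos: "L (tilde u) u > 0" for u
    unfolding L_def
    by (rule integral_as_measure_pos[OF conv_point_positive k(1) compact_bounded_range[OF cpt k(1)] k(2) _ k(3)])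
      (simp add: identity_in_supp tilde_tilde)
  have op: "open (L x -` {0<..})" for x
    by (rule open_vimage[OF open_greaterThan Lc])
  have cov: "UNIV \<subseteq> (\<Union>x\<in>UNIV. L x -` {0<..})" using Lpos by auto
  obtain C where C: "finite C" "UNIV \<subseteq> (\<Union>x\<in>C. L x -` {0<..})"
    by (rule compactE_image[OF cpt op cov])
  define S where "S = (\<lambda>u. \<Sum>x\<in>C. L x u)"
  have Sc: "continuous_on UNIV S" unfolding S_def by (intro continuous_on_sum Lc)
  have Spos: "S u > 0" for u
  proof -
    obtain x where "x \<in> C" "L x u > 0" using C(2) by auto
    then show ?thesis unfolding S_def using C(1) L0 by (intro sum_pos2[of C x]) auto
  qed
  obtain u0 where u0: "\<And>u. S u0 \<le> S u"
    using continuous_attains_inf[OF cpt _ Sc] by auto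
  note int = integrable_continuous_compact[OF cpt finite_haar sets_haar]
  have "S u0 = (LINT u|haar. S u0)" by (simp add: space_haar measure_haar)
  also have "\<dots> \<le> (LINT u|haar. S u)"
    by (rule integral_mono) (auto intro!: int Sc u0)
  also have "\<dots> = (\<Sum>x\<in>C. LINT u|haar. L x u)"
    unfolding S_def by (rule Bochner_Integration.integral_sum) (rule int[OF Lc])
  also have "\<dots> = of_nat (card C) * (LINT x|haar. k x)"
    by (simp add: L_def haar_invariant[OF k(1)])
  finally have "0 < of_nat (card C) * (LINT x|haar. k x)" using Spos[of u0] by simp
  then show ?thesis by (simp add: zero_less_mult_iff)
qed

lemma dual_continuous: "\<phi> \<in> dual conv e tilde \<Longrightarrow> continuous_on UNIV \<phi>"
  by (simp add: dual_def)

text \<open>A bump \<open>k\<close> at \<open>e\<close> makes \<open>u \<mapsto> \<integral> k d(\<delta>\<^sub>w * \<delta>\<^sub>u)\<close> a bump at \<open>tilde w\<close>, uniformly in \<open>w\<close>.\<close>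

lemma approximate_identity:
  assumes \<phi>: "continuous_on UNIV \<phi>" "\<And>x. \<phi> (tilde x) = cnj (\<phi> x)" and eps: "\<epsilon> > 0"
  shows "\<exists>U. open U \<and> e \<in> U \<and> (\<forall>k :: 'a \<Rightarrow> real. continuous_on UNIV k \<and> (\<forall>x. 0 \<le> k x) \<and> (\<forall>x. x \<notin> U \<longrightarrow> k x = 0) \<longrightarrow>
    (\<forall>w. norm ((LINT u|haar. \<phi> u * of_real (LINT z|as_measure (pconv w u). k z)) - of_real (LINT x|haar. k x) * cnj (\<phi> w))
      \<le> \<epsilon> * (LINT x|haar. k x)))"
proof -
  \<comment> \<open>As \<open>cnj (\<phi> w)\<close> is \<open>\<phi> (tilde w)\<close>, these are
    the pairs for which \<open>\<phi> u\<close> is at least \<open>\<epsilon>\<close> away from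
    \<open>\<phi> (tilde w)\<close>: a closed set without pairs \<open>u = tilde w\<close>.\<close>
  define C where "C = {(w, u). \<epsilon> \<le> norm (\<phi> u - cnj (\<phi> w))}"
  have c1: "continuous_on UNIV (\<lambda>p :: 'a \<times> 'a. \<phi> (fst p))" "continuous_on UNIV (\<lambda>p :: 'a \<times> 'a. \<phi> (snd p))"
    by (rule continuous_on_compose2[OF \<phi>(1)]; simp add: continuous_on_fst continuous_on_snd)+
  have "closed {p. \<epsilon> \<le> norm (\<phi> (snd p) - cnj (\<phi> (fst p)))}"
    by (rule closed_Collect_le) (intro continuous_intros c1)+
  moreover have "C = {p. \<epsilon> \<le> norm (\<phi> (snd p) - cnj (\<phi> (fst p)))}" by (auto simp: C_def)
  ultimately have clC: "closed C" by simp
  have neC: "u \<noteq> tilde w" if "(w, u) \<in> C" for w u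
    using that eps by (auto simp: C_def \<phi>(2))
  obtain U where U: "open U" "e \<in> U" "\<forall>w u. (w, u) \<in> C \<longrightarrow> supp (pconv w u) \<inter> U = {}"
    by (rule supp_avoids_identity[OF clC neC])
  have "norm ((LINT u|haar. \<phi> u * of_real (LINT z|as_measure (pconv w u). k z)) - of_real (LINT x|haar. k x) * cnj (\<phi> w))
      \<le> \<epsilon> * (LINT x|haar. k x)"
    if k: "continuous_on UNIV k" "\<And>x. 0 \<le> k x" "\<And>x. x \<notin> U \<Longrightarrow> k x = 0" for k :: "'a \<Rightarrow> real" and w
  proof -
    define L where "L = (\<lambda>u. LINT z|as_measure (pconv w u). k z)"
    have Lc: "continuous_on UNIV L"
      unfolding L_def using continuous_on_section_right[OF continuous_integral_pconv[OF k(1)]] by simp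
    have L0: "L u \<ge> 0" for u
      unfolding L_def by (rule integral_nonneg_AE) (simp add: k(2))
    \<comment> \<open>For a pair in \<open>C\<close> the support avoids \<open>U\<close>, while
      \<open>k\<close> is zero outside \<open>U\<close>.\<close>
    have Lz: "L u = 0" if "(w, u) \<in> C" for u
    proof -
      have "AE z in as_measure (pconv w u). z \<in> supp (pconv w u)"
        by (rule AE_I[of _ _ "- supp (pconv w u)"])
          (use measure_compl_supp[OF conv_point_positive] in auto)
      then have "AE z in as_measure (pconv w u). k z = 0"
      proof eventually_elim
        case (elim z)
        moreover have "supp (pconv w u) \<inter> U = {}" using U(3) that by simp
        ultimately have "z \<notin> U" by blast
        then show ?case by (rule k(3))
      qed
      then show ?thesis unfolding L_def by (rule integral_eq_zero_AE)
    qed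
    have pt: "norm (\<phi> u * of_real (L u) - of_real (L u) * cnj (\<phi> w)) \<le> \<epsilon> * L u" for u
    proof -
      have "\<phi> u * of_real (L u) - of_real (L u) * cnj (\<phi> w) = (\<phi> u - cnj (\<phi> w)) * of_real (L u)"
        by (simp add: algebra_simps)
      then have "norm (\<phi> u * of_real (L u) - of_real (L u) * cnj (\<phi> w)) = norm (\<phi> u - cnj (\<phi> w)) * L u"
        using L0[of u] by (simp add: norm_mult)
      also have "\<dots> \<le> \<epsilon> * L u"
      proof (cases "(w, u) \<in> C")
        case True
        then show ?thesis by (simp add: Lz)
      next
        case False
        then show ?thesis using L0[of u] by (intro mult_right_mono) (auto simp: C_def)
      qed
      finally show ?thesis .
    qed
    note int = integrable_continuous_compact[OF cpt finite_haar sets_haar]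
    \<comment> \<open>By invariance \<open>L\<close> has the same mass as \<open>k\<close>, so the
      error is relative to the integral of \<open>k\<close>.\<close>
    have LI: "(LINT u|haar. L u) = (LINT x|haar. k x)" unfolding L_def by (rule haar_invariant[OF k(1)])
    have i1: "integrable haar (\<lambda>u. \<phi> u * of_real (L u))"
      by (intro int continuous_on_mult \<phi>(1) continuous_on_of_real Lc)
    have i2: "integrable haar (\<lambda>u. of_real (L u) * cnj (\<phi> w))"
      by (intro int continuous_on_mult continuous_on_const continuous_on_of_real Lc)
    have i3: "integrable haar (\<lambda>u. \<epsilon> * L u)"
      by (intro int continuous_on_mult continuous_on_const Lc)
    have "(LINT u|haar. \<phi> u * of_real (L u)) - of_real (LINT x|haar. k x) * cnj (\<phi> w) =
        (LINT u|haar. \<phi> u * of_real (L u) - of_real (L u) * cnj (\<phi> w))"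
      by (simp add: Bochner_Integration.integral_diff[OF i1 i2] LI)
    also have "norm \<dots> \<le> (LINT u|haar. norm (\<phi> u * of_real (L u) - of_real (L u) * cnj (\<phi> w)))"
      by (rule integral_norm_bound)
    also have "\<dots> \<le> (LINT u|haar. \<epsilon> * L u)"
      by (rule integral_mono[OF integrable_norm[OF Bochner_Integration.integrable_diff[OF i1 i2]] i3 pt])
    also have "\<dots> = \<epsilon> * (LINT x|haar. k x)" by (simp add: LI)
    finally show ?thesis by (simp add: L_def)
  qed
  then show ?thesis using U(1,2) by (intro exI[of _ U]) simp
qed

section \<open>Threefold convolutions and double integrals of characters\<close>

definition triple :: "('a \<Rightarrow> real) \<Rightarrow> 'a \<Rightarrow> 'a \<Rightarrow> 'a \<Rightarrow> real" where
  "triple k a y u = (LINT z|as_measure (conv (pconv a y) (point_mass u)). k z)"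

text \<open>Associativity brings the factors at \<open>y\<close> and \<open>u\<close> together,
  where commutativity exchanges them.\<close>

lemma triple_commute: "triple k a y u = triple k a u y"
proof -
  note b = positive_measuresD(1)[OF point_mass_positive]
  have "conv (pconv a y) (point_mass u) = conv (point_mass a) (pconv y u)" by (rule conv_assoc) (rule b)+
  also have "pconv y u = pconv u y" using comm b unfolding commutative_conv_def by blast
  also have "conv (point_mass a) (pconv u y) = conv (pconv a u) (point_mass y)" by (rule conv_assoc[symmetric]) (rule b)+
  finally show ?thesis by (simp add: triple_def)
qed

lemma continuous_triple:
  assumes "continuous_on UNIV k"
  shows "continuous_on UNIV (\<lambda>p. triple k a (fst p) (snd p))"
proof -
  have 1: "continuous_map euclidean weak_topology (\<lambda>p::'a\<times>'a. point_mass (fst p))"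
       "continuous_map euclidean weak_topology (\<lambda>p::'a\<times>'a. point_mass (snd p))"
    by (rule continuous_map_compose[OF _ continuous_map_point_mass, unfolded o_def];
        simp add: continuous_on_fst continuous_on_snd)+
  have "continuous_map euclidean (prod_topology weak_topology weak_topology)
      (\<lambda>p::'a\<times>'a. (point_mass a, point_mass (fst p)))"
    using 1(1) by (simp add: continuous_map_pairedI topspace_weak_topology point_mass_positive)
  from continuous_map_compose[OF this conv_weakly_continuous]
  have "continuous_map euclidean weak_topology (\<lambda>p::'a\<times>'a. pconv a (fst p))" by (simp add: o_def)
  from continuous_integral_conv[OF assms this 1(2)] show ?thesis by (simp add: triple_def)
qed

lemma fubini_haar: "compact_fubini haar haar"
  by (simp add: compact_fubini_def cpt finite_haar sets_haar)

lemma fubini_pconv: "compact_fubini (as_measure (pconv a y)) haar"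
  by (simp add: compact_fubini_def cpt finite_haar sets_haar finite_pconv)

text \<open>By \<open>integral_conv_point_mass\<close>, \<open>triple k a y u\<close> averages over
  \<open>w\<close> the integrals in \<open>bound\<close>. After exchanging integrals the bound
  applies for each \<open>w\<close>; the character equation evaluates the average of
  \<open>cnj (\<phi> w)\<close>, and the error stays \<open>\<delta>\<close> since
  \<open>pconv a y\<close> has mass 1.\<close>

lemma integral_character_triple:
  fixes k :: "'a \<Rightarrow> real"
  assumes \<phi>: "\<phi> \<in> dual conv e tilde" and k: "continuous_on UNIV k"
    and bound: "\<And>w. norm ((LINT u|haar. \<phi> u * of_real (LINT z|as_measure (pconv w u). k z)) -
      of_real (LINT x|haar. k x) * cnj (\<phi> w)) \<le> \<delta>"
  shows "norm ((LINT u|haar. \<phi> u * of_real (triple k a y u)) -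
    of_real (LINT x|haar. k x) * cnj (\<phi> a) * cnj (\<phi> y)) \<le> \<delta>"
proof -
  note \<phi>c = dual_continuous[OF \<phi>]
  define L where "L = (\<lambda>w u. LINT z|as_measure (pconv w u). k z)"
  define \<kappa> where "\<kappa> = complex_of_real (LINT x|haar. k x)"
  define F where "F = (\<lambda>p. \<phi> (snd p) * complex_of_real (L (fst p) (snd p)))"
  interpret fub: compact_fubini "as_measure (pconv a y)" haar by (rule fubini_pconv)
  have "continuous_on UNIV (\<lambda>p. L (fst p) (snd p))"
    using continuous_integral_pconv[OF k] by (simp add: L_def case_prod_unfold)
  moreover have "continuous_on UNIV (\<lambda>p :: 'a \<times> 'a. \<phi> (snd p))"
    by (rule continuous_on_compose2[OF \<phi>c]; simp add: continuous_on_snd)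
  ultimately have Fc: "continuous_on UNIV F" unfolding F_def by (intro continuous_on_mult continuous_on_of_real)
  have "triple k a y u = (LINT w|as_measure (pconv a y). L w u)" for u
    unfolding triple_def L_def by (rule integral_conv_point_mass[OF k conv_point_positive])
  then have "(LINT u|haar. \<phi> u * of_real (triple k a y u)) = (LINT u|haar. LINT w|as_measure (pconv a y). F (w, u))"
    by (simp add: F_def)
  also have "\<dots> = (LINT w|as_measure (pconv a y). LINT u|haar. F (w, u))"
    by (rule fub.integral_swap[OF Fc])
  finally have 1: "(LINT u|haar. \<phi> u * of_real (triple k a y u)) = (LINT w|as_measure (pconv a y). LINT u|haar. F (w, u))" .
  have "(LINT w|as_measure (pconv a y). \<kappa> * cnj (\<phi> w)) = \<kappa> * cnj (LINT w|as_measure (pconv a y). \<phi> w)"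
    by simp
  also have "(LINT w|as_measure (pconv a y). \<phi> w) = \<phi> a * \<phi> y" using \<phi> by (simp add: dual_def)
  finally have 2: "(LINT w|as_measure (pconv a y). \<kappa> * cnj (\<phi> w)) = \<kappa> * cnj (\<phi> a) * cnj (\<phi> y)" by simp
  have "norm ((LINT w|as_measure (pconv a y). LINT u|haar. F (w, u)) - (LINT w|as_measure (pconv a y). \<kappa> * cnj (\<phi> w)))
      \<le> \<delta> * measure (as_measure (pconv a y)) UNIV"
  proof (rule norm_integral_diff_le[OF cpt finite_pconv sets_as_measure])
    show "continuous_on UNIV (\<lambda>w. LINT u|haar. F (w, u))" by (rule fub.continuous_integral_section'[OF Fc])
    show "continuous_on UNIV (\<lambda>w. \<kappa> * cnj (\<phi> w))" by (intro continuous_intros \<phi>c)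
    show "norm ((LINT u|haar. F (w, u)) - \<kappa> * cnj (\<phi> w)) \<le> \<delta>" for w
      using bound[of w] by (simp add: F_def L_def \<kappa>_def)
  qed
  then show ?thesis
    unfolding 1 \<kappa>_def[symmetric] 2[symmetric] by (simp only: measure_pconv mult_1_right)
qed

text \<open>Multiplying the previous estimate by \<open>\<psi> y\<close> costs a factor
  \<open>B\<close>, and integrating over \<open>y\<close> costs nothing since the Haar measure has
  mass 1.\<close>

lemma double_integral_characters:
  fixes k :: "'a \<Rightarrow> real"
  assumes \<phi>: "\<phi> \<in> dual conv e tilde" and \<psi>: "continuous_on UNIV \<psi>" "\<And>x. norm (\<psi> x) \<le> B"
    and k: "continuous_on UNIV k"
    and bound: "\<And>w. norm ((LINT u|haar. \<phi> u * of_real (LINT z|as_measure (pconv w u). k z)) -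
      of_real (LINT x|haar. k x) * cnj (\<phi> w)) \<le> \<delta>"
  shows "norm ((LINT y|haar. \<psi> y * (LINT u|haar. \<phi> u * of_real (triple k a y u))) -
    of_real (LINT x|haar. k x) * cnj (\<phi> a) * (LINT x|haar. \<psi> x * cnj (\<phi> x))) \<le> B * \<delta>"
proof -
  note \<phi>c = dual_continuous[OF \<phi>]
  define \<kappa> where "\<kappa> = complex_of_real (LINT x|haar. k x)"
  interpret fub: compact_fubini haar haar by (rule fubini_haar)
  have "continuous_on UNIV (\<lambda>p :: 'a \<times> 'a. \<phi> (snd p))"
    by (rule continuous_on_compose2[OF \<phi>c]; simp add: continuous_on_snd)
  then have Fc: "continuous_on UNIV (\<lambda>p. \<phi> (snd p) * complex_of_real (triple k a (fst p) (snd p)))"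
    by (intro continuous_on_mult continuous_on_of_real continuous_triple k)
  have "norm ((LINT y|haar. \<psi> y * (LINT u|haar. \<phi> u * of_real (triple k a y u))) -
      (LINT y|haar. \<psi> y * (\<kappa> * cnj (\<phi> a) * cnj (\<phi> y)))) \<le> B * \<delta> * measure haar UNIV"
  proof (rule norm_integral_diff_le[OF cpt finite_haar sets_haar])
    show "continuous_on UNIV (\<lambda>y. \<psi> y * (LINT u|haar. \<phi> u * of_real (triple k a y u)))"
      using fub.continuous_integral_section'[OF Fc] by (simp add: continuous_on_mult \<psi>(1))
    show "continuous_on UNIV (\<lambda>y. \<psi> y * (\<kappa> * cnj (\<phi> a) * cnj (\<phi> y)))"
      by (intro continuous_intros \<phi>c \<psi>)
    fix y
    have "norm (\<psi> y) * norm ((LINT u|haar. \<phi> u * of_real (triple k a y u)) - \<kappa> * cnj (\<phi> a) * cnj (\<phi> y)) \<le> B * \<delta>"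
      using \<psi>(2)[of y] integral_character_triple[OF \<phi> k bound, of a y]
      by (intro mult_mono) (auto simp: \<kappa>_def intro: order_trans[OF norm_ge_zero])
    then show "norm (\<psi> y * (LINT u|haar. \<phi> u * of_real (triple k a y u)) - \<psi> y * (\<kappa> * cnj (\<phi> a) * cnj (\<phi> y))) \<le> B * \<delta>"
      by (simp add: norm_mult[symmetric] right_diff_distrib)
  qed
  moreover have "(LINT y|haar. \<psi> y * (\<kappa> * cnj (\<phi> a) * cnj (\<phi> y))) = (LINT y|haar. \<kappa> * cnj (\<phi> a) * (\<psi> y * cnj (\<phi> y)))"
    by (simp only: mult_ac)
  ultimately show ?thesis by (simp add: measure_haar \<kappa>_def)
qed

text \<open>\<open>triple_commute\<close> exchanges the variables in the kernel and Fubini exchanges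
  the integrals; renaming them gives the right side.\<close>

lemma double_integral_commute:
  fixes \<phi> \<psi> :: "'a \<Rightarrow> complex" and k :: "'a \<Rightarrow> real"
  assumes "continuous_on UNIV \<phi>" "continuous_on UNIV \<psi>" "continuous_on UNIV k"
  shows "(LINT y|haar. \<psi> y * (LINT u|haar. \<phi> u * of_real (triple k a y u))) =
    (LINT y|haar. \<phi> y * (LINT u|haar. \<psi> u * of_real (triple k a y u)))"
proof -
  interpret fub: compact_fubini haar haar by (rule fubini_haar)
  define F where "F = (\<lambda>p. \<psi> (snd p) * \<phi> (fst p) * complex_of_real (triple k a (fst p) (snd p)))"
  have "continuous_on UNIV (\<lambda>p :: 'a \<times> 'a. \<phi> (fst p))" "continuous_on UNIV (\<lambda>p :: 'a \<times> 'a. \<psi> (snd p))"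
    by (rule continuous_on_compose2[OF assms(1)]; simp add: continuous_on_fst)
      (rule continuous_on_compose2[OF assms(2)]; simp add: continuous_on_snd)
  then have Fc: "continuous_on UNIV F"
    unfolding F_def by (intro continuous_on_mult continuous_on_of_real continuous_triple assms)
  have "(LINT y|haar. \<psi> y * (LINT u|haar. \<phi> u * of_real (triple k a y u))) = (LINT y|haar. LINT u|haar. F (u, y))"
    by (simp add: F_def mult.assoc triple_commute[of k a])
  also have "\<dots> = (LINT u|haar. LINT y|haar. F (u, y))" by (rule fub.integral_swap[OF Fc])
  also have "\<dots> = (LINT u|haar. \<phi> u * (LINT y|haar. \<psi> y * of_real (triple k a u y)))"
    by (simp add: F_def mult.assoc mult.left_commute[of "\<psi> _"])
  finally show ?thesis .
qed

text \<open>One double integral is approximated in two ways, so the main terms differ by a small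
  multiple of the integral of the bump; dividing by that integral leaves an arbitrarily small
  bound.\<close>

lemma character_inner_product:
  assumes \<phi>: "\<phi> \<in> dual conv e tilde" and \<psi>: "\<psi> \<in> dual conv e tilde"
  shows "cnj (\<phi> a) * (LINT x|haar. \<psi> x * cnj (\<phi> x)) = cnj (\<psi> a) * (LINT x|haar. \<phi> x * cnj (\<psi> x))"
proof -
  note \<phi>c = dual_continuous[OF \<phi>] and \<psi>c = dual_continuous[OF \<psi>]
  let ?c = "LINT x|haar. \<psi> x * cnj (\<phi> x)" and ?d = "LINT x|haar. \<phi> x * cnj (\<psi> x)"
  obtain B1 where B1: "\<And>x. norm (\<phi> x) \<le> B1" using compact_bounded_range[OF cpt \<phi>c] by (auto simp: bounded_iff)
  obtain B2 where B2: "\<And>x. norm (\<psi> x) \<le> B2" using compact_bounded_range[OF cpt \<psi>c] by (auto simp: bounded_iff)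
  have B: "B1 \<ge> 0" "B2 \<ge> 0" using B1[of e] B2[of e] norm_ge_zero order_trans by blast+
  have "norm (cnj (\<phi> a) * ?c - cnj (\<psi> a) * ?d) \<le> \<epsilon>" if "\<epsilon> > 0" for \<epsilon>
  proof -
    \<comment> \<open>The two approximation errors, relative to the bump, add up to
      \<open>(B1 + B2) * d\<close>.\<close>
    define d where "d = \<epsilon> / (B1 + B2 + 1)"
    have d: "d > 0" using B that by (simp add: d_def)
    have t\<phi>: "\<phi> (tilde x) = cnj (\<phi> x)" and t\<psi>: "\<psi> (tilde x) = cnj (\<psi> x)" for x
      using \<phi> \<psi> by (simp_all add: dual_def)
    obtain U where U: "open U" "e \<in> U" "\<And>(k :: 'a \<Rightarrow> real) w. continuous_on UNIV k \<Longrightarrow> \<forall>x. 0 \<le> k x \<Longrightarrow> \<forall>x. x \<notin> U \<longrightarrow> k x = 0 \<Longrightarrow>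
      norm ((LINT u|haar. \<phi> u * of_real (LINT z|as_measure (pconv w u). k z)) - of_real (LINT x|haar. k x) * cnj (\<phi> w))
      \<le> d * (LINT x|haar. k x)"
      using approximate_identity[OF \<phi>c t\<phi> d] by auto
    obtain V where V: "open V" "e \<in> V" "\<And>(k :: 'a \<Rightarrow> real) w. continuous_on UNIV k \<Longrightarrow> \<forall>x. 0 \<le> k x \<Longrightarrow> \<forall>x. x \<notin> V \<longrightarrow> k x = 0 \<Longrightarrow>
      norm ((LINT u|haar. \<psi> u * of_real (LINT z|as_measure (pconv w u). k z)) - of_real (LINT x|haar. k x) * cnj (\<psi> w))
      \<le> d * (LINT x|haar. k x)"
      using approximate_identity[OF \<psi>c t\<psi> d] by auto
    have cl: "closed (- (U \<inter> V))" using U(1) V(1) by (simp add: closed_def open_Int)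
    \<comment> \<open>A bump vanishing outside both neighbourhoods serves both characters at
      once.\<close>
    obtain k :: "'a \<Rightarrow> real" where k: "continuous_on UNIV k" "\<And>x. 0 \<le> k x"
      "\<And>x. x \<in> - (U \<inter> V) \<Longrightarrow> k x = 0" "\<And>x. x \<in> {e} \<Longrightarrow> k x = 1"
      by (rule compact_urysohn[OF cpt cl closed_singleton[of e]]) (use U(2) V(2) in auto)
    define \<kappa> where "\<kappa> = (LINT x|haar. k x)"
    have \<kappa>: "\<kappa> > 0" unfolding \<kappa>_def by (rule haar_pos[OF k(1,2)]) (simp add: k(4))
    have b1: "norm ((LINT u|haar. \<phi> u * of_real (LINT z|as_measure (pconv w u). k z)) - of_real (LINT x|haar. k x) * cnj (\<phi> w)) \<le> d * \<kappa>" for w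
      unfolding \<kappa>_def by (rule U(3)) (use k in auto)
    have b2: "norm ((LINT u|haar. \<psi> u * of_real (LINT z|as_measure (pconv w u). k z)) - of_real (LINT x|haar. k x) * cnj (\<psi> w)) \<le> d * \<kappa>" for w
      unfolding \<kappa>_def by (rule V(3)) (use k in auto)
    note i1 = double_integral_characters[OF \<phi> \<psi>c B2 k(1) b1, of a]
      and i2 = double_integral_characters[OF \<psi> \<phi>c B1 k(1) b2, of a]
    \<comment> \<open>By symmetry the double integral becomes literally the one in
      \<open>i2\<close>, so the triangle inequality eliminates it.\<close>
    note i1' = i1[unfolded double_integral_commute[OF \<phi>c \<psi>c k(1)] norm_minus_commute[of "LINT y|haar. _ y"]]
    have "norm (of_real \<kappa> * cnj (\<phi> a) * ?c - of_real \<kappa> * cnj (\<psi> a) * ?d) \<le> B2 * (d * \<kappa>) + B1 * (d * \<kappa>)"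
      unfolding \<kappa>_def by (rule norm_diff_triangle_le[OF i1'[unfolded \<kappa>_def] i2[unfolded \<kappa>_def]])
    also have "of_real \<kappa> * cnj (\<phi> a) * ?c - of_real \<kappa> * cnj (\<psi> a) * ?d = of_real \<kappa> * (cnj (\<phi> a) * ?c - cnj (\<psi> a) * ?d)"
      by (simp only: right_diff_distrib mult.assoc)
    also have "norm (of_real \<kappa> * (cnj (\<phi> a) * ?c - cnj (\<psi> a) * ?d)) = \<kappa> * norm (cnj (\<phi> a) * ?c - cnj (\<psi> a) * ?d)"
      using \<kappa> by (simp add: norm_mult)
    also have "B2 * (d * \<kappa>) + B1 * (d * \<kappa>) = \<kappa> * ((B1 + B2) * d)" by (simp add: algebra_simps)
    finally have "\<kappa> * norm (cnj (\<phi> a) * ?c - cnj (\<psi> a) * ?d) \<le> \<kappa> * ((B1 + B2) * d)" .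
    then have "norm (cnj (\<phi> a) * ?c - cnj (\<psi> a) * ?d) \<le> (B1 + B2) * d" using \<kappa> by simp
    also have "\<dots> \<le> (B1 + B2 + 1) * d" using d by simp
    also have "\<dots> = \<epsilon>" using B by (simp add: d_def)
    finally show ?thesis .
  qed
  then have "norm (cnj (\<phi> a) * ?c - cnj (\<psi> a) * ?d) \<le> 0" by (rule field_le_epsilon) simp
  then show ?thesis by simp
qed

lemma character_orthogonality:
  assumes \<phi>: "\<phi> \<in> dual conv e tilde" and \<psi>: "\<psi> \<in> dual conv e tilde" and ne: "\<phi> \<noteq> \<psi>"
  shows "(LINT x|haar. \<psi> x * cnj (\<phi> x)) = 0"
proof -
  have "\<phi> e = 1" "\<psi> e = 1" using \<phi> \<psi> by (simp_all add: dual_def)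
  then have "(LINT x|haar. \<psi> x * cnj (\<phi> x)) = (LINT x|haar. \<phi> x * cnj (\<psi> x))"
    using character_inner_product[OF \<phi> \<psi>, of e] by simp
  moreover obtain a where "\<phi> a \<noteq> \<psi> a" using ne by blast
  ultimately show ?thesis using character_inner_product[OF \<phi> \<psi>, of a] by auto
qed

section \<open>Hyperdimension and Plancherel mass of a character\<close>

lemma character_norm:
  assumes \<phi>: "\<phi> \<in> dual conv e tilde"
  shows "(LINT x|haar. \<phi> x * cnj (\<phi> x)) = of_real (LINT x|haar. (norm (\<phi> x))\<^sup>2)"
    "(LINT x|haar. (norm (\<phi> x))\<^sup>2) > 0"
proof -
  show "(LINT x|haar. \<phi> x * cnj (\<phi> x)) = of_real (LINT x|haar. (norm (\<phi> x))\<^sup>2)"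
    by (simp flip: complex_norm_square of_real_power)
  \<comment> \<open>The squared modulus is continuous, nonnegative and equal to 1 at
    \<open>e\<close>.\<close>
  show "(LINT x|haar. (norm (\<phi> x))\<^sup>2) > 0"
    using \<phi> by (intro haar_pos continuous_intros dual_continuous) (auto simp: dual_def)
qed

text \<open>The definite description needs exactly one candidate: orthogonality supplies existence,
  and the case \<open>\<psi> = \<pi>\<close> uniqueness.\<close>

lemma hyperdimension_eq:
  assumes \<pi>: "\<pi> \<in> dual conv e tilde"
  shows "hyperdimension conv e tilde haar \<pi> = 1 / (LINT x|haar. (norm (\<pi> x))\<^sup>2)"
  unfolding hyperdimension_def
proof (rule the_equality)
  let ?r = "LINT x|haar. (norm (\<pi> x))\<^sup>2"
  show "0 < 1 / ?r \<and> (\<forall>\<psi>\<in>dual conv e tilde. (LINT x|haar. \<pi> x * cnj (\<psi> x)) =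
      (if \<psi> = \<pi> then complex_of_real (1 / (1 / ?r)) else 0))"
    using character_norm[OF \<pi>] character_orthogonality[OF _ \<pi>] by auto
next
  fix k assume k: "0 < k \<and> (\<forall>\<psi>\<in>dual conv e tilde. (LINT x|haar. \<pi> x * cnj (\<psi> x)) =
      (if \<psi> = \<pi> then complex_of_real (1 / k) else 0))"
  then have "complex_of_real (1 / k) = of_real (LINT x|haar. (norm (\<pi> x))\<^sup>2)"
    using \<pi> character_norm(1)[OF \<pi>] by auto
  then have "1 / k = (LINT x|haar. (norm (\<pi> x))\<^sup>2)" by (simp only: of_real_eq_iff)
  then show "k = 1 / (LINT x|haar. (norm (\<pi> x))\<^sup>2)" using k by (metis divide_divide_eq_right div_by_1 mult_1)
qed

lemma plancherel_singleton:
  assumes P: "plancherel_measure conv e tilde haar P" and \<pi>: "\<pi> \<in> dual conv e tilde"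
  shows "emeasure P {\<pi>} = ennreal (1 / (LINT x|haar. (norm (\<pi> x))\<^sup>2))"
proof -
  define r where "r = (LINT x|haar. (norm (\<pi> x))\<^sup>2)"
  have r: "r > 0" unfolding r_def by (rule character_norm(2)[OF \<pi>])
  have sp: "space P = dual conv e tilde" "sets P = Pow (dual conv e tilde)"
    using P by (simp_all add: plancherel_measure_def)
  note \<pi>c = dual_continuous[OF \<pi>]
  have "integrable haar (\<lambda>x. (norm (\<pi> x))\<^sup>2)"
    by (intro integrable_continuous_compact[OF cpt finite_haar sets_haar] continuous_intros \<pi>c)
  then have "\<pi> \<in> square_integrable haar"
    by (simp add: square_integrable_def measurable_cong_sets[OF sets_haar refl]
        borel_measurable_continuous_onI \<pi>c)
  then have 1: "fourier haar \<pi> \<in> square_integrable P"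
    "(LINT \<phi>|P. (norm (fourier haar \<pi> \<phi>))\<^sup>2) = r"
    using P by (auto simp: plancherel_measure_def r_def)
  \<comment> \<open>By orthogonality the transform of \<open>\<pi>\<close> vanishes away from
    \<open>\<pi>\<close>; at \<open>\<pi>\<close> it equals \<open>r\<close>.\<close>
  have F: "(norm (fourier haar \<pi> \<phi>))\<^sup>2 = r\<^sup>2 * indicat_real {\<pi>} \<phi>" if "\<phi> \<in> space P" for \<phi>
  proof (cases "\<phi> = \<pi>")
    case True
    then show ?thesis using r character_norm(1)[OF \<pi>] by (simp add: fourier_def r_def norm_power)
  next
    case False
    then show ?thesis using character_orthogonality[OF _ \<pi> False] that sp by (simp add: fourier_def)
  qed
  have "integrable P (\<lambda>\<phi>. (norm (fourier haar \<pi> \<phi>))\<^sup>2) = integrable P (\<lambda>\<phi>. r\<^sup>2 * indicat_real {\<pi>} \<phi>)"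
    by (rule Bochner_Integration.integrable_cong[OF refl F])
  then have "integrable P (\<lambda>\<phi>. r\<^sup>2 * indicat_real {\<pi>} \<phi>)"
    using 1(1) by (simp add: square_integrable_def)
  \<comment> \<open>Square integrability of the transform makes the mass of \<open>{\<pi>}\<close>
    finite, which the final passage from \<open>measure\<close> back to \<open>emeasure\<close>
    uses.\<close>
  then have "integrable P (indicat_real {\<pi>})" using r by simp
  then have fin: "emeasure P {\<pi>} < \<infinity>" using \<pi> sp by (simp add: integrable_indicator_iff)
  have "(LINT \<phi>|P. (norm (fourier haar \<pi> \<phi>))\<^sup>2) = (LINT \<phi>|P. r\<^sup>2 * indicat_real {\<pi>} \<phi>)"
    by (rule Bochner_Integration.integral_cong[OF refl F])
  then have "r = (LINT \<phi>|P. r\<^sup>2 * indicat_real {\<pi>} \<phi>)" using 1(2) by simp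
  also have "\<dots> = r\<^sup>2 * measure P {\<pi>}" using \<pi> sp by simp
  finally have "measure P {\<pi>} = 1 / r" using r by (simp add: power2_eq_square field_simps)
  then show ?thesis using fin by (simp add: emeasure_eq_ennreal_measure r_def)
qed

end

theorem proposition1p2:
  fixes conv :: "'a::t2_space cmeasure \<Rightarrow> 'a cmeasure \<Rightarrow> 'a cmeasure"
    and e :: 'a
    and tilde :: "'a \<Rightarrow> 'a"
    and haar :: "'a measure"
    and planch :: "('a \<Rightarrow> complex) measure"
  assumes "hypergroup conv e tilde"
    and "commutative_conv conv"
    and "compact (UNIV :: 'a set)"
    and "haar_measure conv haar"
    and "emeasure haar UNIV = 1"
    and "plancherel_measure conv e tilde haar planch"
  shows "\<forall>\<pi>\<in>dual conv e tilde. emeasure planch {\<pi>} = ennreal (hyperdimension conv e tilde haar \<pi>)"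
proof -
  interpret normalized_haar conv e tilde haar
    by (simp add: normalized_haar_def normalized_haar_axioms_def compact_commutative_hypergroup_def
        compact_commutative_hypergroup_axioms_def assms)
  show ?thesis by (simp add: plancherel_singleton[OF assms(6)] hyperdimension_eq)
qed

end
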